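(* Let $\mathcal{P}$ be a set of positive real algebraic numbers, let $\operatorname{gp}(\mathcal{P})$ be the subgroup of $\mathbb{R}^\times_{>0}$ generated by $\mathcal{P}$, and set $B=\ln(\operatorname{gp}(\mathcal{P}))=\{\ln p\mid p\in\operatorname{gp}(\mathcal{P})\}$, a subgroup of the additive group $\mathbb{R}$. If $B$ is free abelian of positive rank (possibly infinite), then $U(B)=\{1,-1\}$.
   Context: For a subgroup $B$ of the additive group $\mathbb{R}$, the group of units of $B$ is $U(B)=\{s\in\mathbb{R}^\times\mid s\cdot B=B\}$. *)

theory Defs
  imports
    Complex_Main
    "HOL-Algebra.Generated_Groups"
    "HOL-Algebra.Free_Abelian_Groups"
    "HOL-Computational_Algebra.Polynomial"
begin

definition pos_real_mult_group :: "real monoid"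
  where "pos_real_mult_group = \<lparr>carrier = {x. 0 < x}, monoid.mult = (*), one = 1\<rparr>"

definition real_add_group :: "real monoid"
  where "real_add_group = \<lparr>carrier = UNIV, monoid.mult = (+), one = 0\<rparr>"

lemma group_pos_real_mult_group: "group pos_real_mult_group"
proof (rule groupI)
  show "\<exists>y\<in>carrier pos_real_mult_group. y \<otimes>\<^bsub>pos_real_mult_group\<^esub> x = \<one>\<^bsub>pos_real_mult_group\<^esub>"
    if "x \<in> carrier pos_real_mult_group" for x
    using that by (intro bexI[of _ "inverse x"]) (auto simp: pos_real_mult_group_def)
qed (auto simp: pos_real_mult_group_def)

lemma inv_pos_real_mult_group:
  assumes "0 < x"
  shows "inv\<^bsub>pos_real_mult_group\<^esub> x = inverse x"
  by (rule group.inv_equality[OF group_pos_real_mult_group])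
     (use assms in \<open>auto simp: pos_real_mult_group_def\<close>)

lemma group_real_add_group: "group real_add_group"
proof (rule groupI)
  show "\<exists>y\<in>carrier real_add_group. y \<otimes>\<^bsub>real_add_group\<^esub> x = \<one>\<^bsub>real_add_group\<^esub>" for x
    by (intro bexI[of _ "- x"]) (auto simp: real_add_group_def)
qed (auto simp: real_add_group_def)

lemma inv_real_add_group: "inv\<^bsub>real_add_group\<^esub> x = - x"
  by (rule group.inv_equality[OF group_real_add_group]) (auto simp: real_add_group_def)

text \<open>Only meaningful for sets of positive reals: \<open>generate\<close> does not intersect its
  generators with the carrier.\<close>

definition gp :: "real set \<Rightarrow> real set"
  where "gp P = generate pos_real_mult_group P"

definition unit_group :: "real set \<Rightarrow> real set"
  where "unit_group B = {s. s \<noteq> 0 \<and> (\<lambda>b. s * b) ` B = B}"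

text \<open>The rank is the cardinality of the index set \<open>S\<close>, so positive rank means that \<open>S\<close> is
  nonempty; \<open>S\<close> may be infinite. A basis of \<open>G\<close> is a subset of the carrier, so taking \<open>S\<close> over
  the element type of \<open>G\<close> loses no generality, as \<open>free_abelian_positive_rankI\<close> shows.\<close>

definition free_abelian_positive_rank :: "('a, 'b) monoid_scheme \<Rightarrow> bool"
  where "free_abelian_positive_rank G \<longleftrightarrow> (\<exists>S::'a set. S \<noteq> {} \<and> free_Abelian_group S \<cong> G)"

lemma free_abelian_positive_rankI:
  fixes S :: "'c set" and G :: "('a, 'b) monoid_scheme"
  assumes "S \<noteq> {}" and iso: "free_Abelian_group S \<cong> G"
  shows "free_abelian_positive_rank G"
proof -
  from iso obtain h where h: "h \<in> iso (free_Abelian_group S) G"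
    by (auto simp: is_iso_def)
  define T where "T = (\<lambda>x. h (frag_of x)) ` S"
  have inj_h: "inj_on h (carrier (free_Abelian_group S))"
    using h by (auto simp: iso_def bij_betw_def)
  have "inj_on (\<lambda>x. h (frag_of x)) S"
  proof (rule inj_onI)
    fix x y assume "x \<in> S" "y \<in> S" "h (frag_of x) = h (frag_of y)"
    then have "frag_of x = frag_of y"
      using inj_onD[OF inj_h] by auto
    then have "Poly_Mapping.keys (frag_of x) = Poly_Mapping.keys (frag_of y)" by simp
    then show "x = y" by simp
  qed
  then have "S \<approx> T"
    unfolding T_def eqpoll_def bij_betw_def by blast
  then have "free_Abelian_group T \<cong> free_Abelian_group S"
    by (simp add: isomorphic_free_Abelian_groups eqpoll_sym)
  then have "free_Abelian_group T \<cong> G"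
    using iso by (rule iso_trans)
  moreover have "T \<noteq> {}"
    using assms(1) by (simp add: T_def)
  ultimately show ?thesis
    unfolding free_abelian_positive_rank_def by blast
qed

lemma subgroup_gp:
  assumes "\<And>p. p \<in> P \<Longrightarrow> 0 < p"
  shows "subgroup (gp P) pos_real_mult_group"
  unfolding gp_def
  by (rule group.generate_is_subgroup[OF group_pos_real_mult_group])
     (use assms in \<open>auto simp: pos_real_mult_group_def\<close>)

lemma subgroup_ln_gp:
  assumes "\<And>p. p \<in> P \<Longrightarrow> 0 < p"
  shows "subgroup (ln ` gp P) real_add_group"
proof -
  have "ln \<in> hom pos_real_mult_group real_add_group"
    by (auto simp: hom_def pos_real_mult_group_def real_add_group_def ln_mult)
  then interpret group_hom pos_real_mult_group real_add_group ln
    by (simp add: group_hom_def group_hom_axioms_def group_pos_real_mult_group group_real_add_group)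
  show ?thesis
    using subgroup_gp[OF assms] by (rule subgroup_img_is_subgroup)
qed

end

theory Submission
  imports Defs "Jordan_Normal_Form.Char_Poly"
begin

text \<open>
  Let \<open>s\<close> be a unit of \<open>B\<close>. If \<open>s\<close> is rational, then \<open>B\<close> is divisible by the numerator and by the
  denominator of \<open>s\<close>; a nonzero free abelian group is divisible by \<open>1\<close> and \<open>-1\<close> only, so \<open>s = 1\<close> or \<open>s = -1\<close>
  (\<open>rational_unit_eq_one\<close>).

  The real content is that \<open>s\<close> cannot be irrational. Choose \<open>l \<noteq> 0\<close> in \<open>B\<close>. Since \<open>s B = B\<close>, all
  numbers \<open>l s\<^sup>k\<close> lie in \<open>B\<close>, that is, every \<open>exp (l s\<^sup>k)\<close> is algebraic. If \<open>s\<close> is algebraic, this contradicts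
  the Gelfond-Schneider theorem, applied to \<open>exp l\<close> and \<open>exp (l s)\<close>. If \<open>s\<close> is transcendental, then \<open>1, s, s\<^sup>2\<close>
  are linearly independent over the rationals, and the algebraicity of \<open>exp (l s\<^sup>k)\<close> for \<open>k < 5\<close>
  contradicts the six exponentials theorem.

  Both facts are needed over the reals only and come from one argument
  (\<open>exponential_values_contradiction\<close>). The pigeonhole principle gives an integral combination \<open>F\<close> of
  functions \<open>z ^ a * exp (\<omega> * z)\<close> whose first Taylor coefficients at 0 are very small
  (\<open>small_linear_forms\<close>). Then \<open>F\<close> is very small at all points of a finite set \<open>Y\<close> where its values are
  algebraic, hence zero there by Liouville's inequality (\<open>liouville_bound\<close>). But \<open>Y\<close> has as many points as \<open>F\<close>
  has coefficients, and by Rolle's theorem a nonzero real exponential polynomial has fewer zeros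
  (\<open>exponential_polynomial_card_zeros\<close>).

  Heights are measured without number fields. Multiplication by an algebraic number, after clearing
  a denominator, preserves a finitely generated additive group of reals, and the size of the number is the row sum
  norm of an integer matrix that describes this action. A nonzero eigenvalue of an integer matrix is bounded below
  because the product of all the nonzero eigenvalues is a nonzero integer.
\<close>

section \<open>Algebraic numbers as integer matrices\<close>

definition int_span :: "real set \<Rightarrow> real set"
  where "int_span V = {(\<Sum>w\<in>V. of_int (a w) * w) | a. True}"

text \<open>
  \<open>A\<close> is the matrix of multiplication by \<open>x\<close> on the possibly dependent generators \<open>V\<close>, so it is not
  unique. The bound \<open>H\<close> is on its operator norm for the maximum norm, which is subadditive and
  submultiplicative; \<open>H\<close> therefore plays the part of a height that is easy to compute with.
\<close>

definition acts_on_span :: "real set \<Rightarrow> real \<Rightarrow> int \<Rightarrow> bool"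
  where "acts_on_span V x H \<longleftrightarrow>
    (\<exists>A. \<forall>v\<in>V. x * v = (\<Sum>w\<in>V. of_int (A v w) * w) \<and> (\<Sum>w\<in>V. \<bar>A v w\<bar>) \<le> H)"

lemma int_spanI: "x = (\<Sum>w\<in>V. of_int (a w) * w) \<Longrightarrow> x \<in> int_span V"
  unfolding int_span_def by blast

lemma int_span_base:
  assumes "finite V" "v \<in> V"
  shows "v \<in> int_span V"
  by (rule int_spanI[where a = "\<lambda>w. if w = v then 1 else 0"])
     (use assms in \<open>simp add: if_distrib[of "\<lambda>x. of_int x * _"] sum.delta cong: if_cong\<close>)

lemma int_span_add:
  assumes "x \<in> int_span V" "y \<in> int_span V"
  shows "x + y \<in> int_span V"
proof -
  obtain a b where ab: "x = (\<Sum>w\<in>V. of_int (a w) * w)" "y = (\<Sum>w\<in>V. of_int (b w) * w)"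
    using assms unfolding int_span_def by blast
  show ?thesis
    by (rule int_spanI[where a = "\<lambda>w. a w + b w"])
       (simp add: ab sum.distrib algebra_simps)
qed

lemma int_span_scale:
  assumes "x \<in> int_span V"
  shows "of_int k * x \<in> int_span V"
proof -
  obtain a where a: "x = (\<Sum>w\<in>V. of_int (a w) * w)"
    using assms unfolding int_span_def by blast
  show ?thesis
    by (rule int_spanI[where a = "\<lambda>w. k * a w"]) (simp add: a sum_distrib_left algebra_simps)
qed

lemma int_span_0: "0 \<in> int_span V"
  by (rule int_spanI[where a = "\<lambda>_. 0"]) simp

lemma int_span_sum:
  "(\<And>i. i \<in> I \<Longrightarrow> f i \<in> int_span V) \<Longrightarrow> (\<Sum>i\<in>I. f i) \<in> int_span V"
  by (induction I rule: infinite_finite_induct) (auto intro: int_span_0 int_span_add)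

lemma acts_on_span_iff_stable:
  assumes "finite V"
  shows "(\<exists>H. acts_on_span V x H) \<longleftrightarrow> (\<forall>v\<in>V. x * v \<in> int_span V)"
proof
  assume "\<exists>H. acts_on_span V x H"
  then show "\<forall>v\<in>V. x * v \<in> int_span V"
    unfolding acts_on_span_def by (auto intro: int_spanI)
next
  assume "\<forall>v\<in>V. x * v \<in> int_span V"
  then have "\<forall>v\<in>V. \<exists>a. x * v = (\<Sum>w\<in>V. of_int (a w) * w)"
    unfolding int_span_def by auto
  then obtain A where A: "\<forall>v\<in>V. x * v = (\<Sum>w\<in>V. of_int (A v w) * w)"
    by (auto simp: bchoice_iff)
  have "(\<Sum>w\<in>V. \<bar>A v w\<bar>) \<le> (\<Sum>v\<in>V. \<Sum>w\<in>V. \<bar>A v w\<bar>)" if "v \<in> V" for v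
    using assms that
    by (intro member_le_sum[of v V "\<lambda>v. \<Sum>w\<in>V. \<bar>A v w\<bar>"]) (auto intro: sum_nonneg)
  with A show "\<exists>H. acts_on_span V x H"
    unfolding acts_on_span_def by auto
qed

lemma acts_on_span_of_int:
  assumes "finite V"
  shows "acts_on_span V (of_int k) \<bar>k\<bar>"
  unfolding acts_on_span_def
proof (intro exI[of _ "\<lambda>v w. if w = v then k else 0"] ballI conjI)
  fix v assume v: "v \<in> V"
  show "of_int k * v = (\<Sum>w\<in>V. of_int (if w = v then k else 0) * w)"
    using v assms by (simp add: if_distrib[of "\<lambda>x. of_int x * _"] sum.delta cong: if_cong)
  show "(\<Sum>w\<in>V. \<bar>if w = v then k else 0\<bar>) \<le> \<bar>k\<bar>"
    using v assms by (simp add: if_distrib[of abs] sum.delta cong: if_cong)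
qed

lemma acts_on_span_mono:
  "acts_on_span V x H \<Longrightarrow> H \<le> K \<Longrightarrow> acts_on_span V x K"
  unfolding acts_on_span_def by (meson order_trans)

lemma acts_on_span_add:
  assumes "acts_on_span V x H" "acts_on_span V y K"
  shows "acts_on_span V (x + y) (H + K)"
proof -
  obtain A where A: "\<And>v. v \<in> V \<Longrightarrow> x * v = (\<Sum>w\<in>V. of_int (A v w) * w)"
    "\<And>v. v \<in> V \<Longrightarrow> (\<Sum>w\<in>V. \<bar>A v w\<bar>) \<le> H"
    using assms(1) unfolding acts_on_span_def by blast
  obtain B where B: "\<And>v. v \<in> V \<Longrightarrow> y * v = (\<Sum>w\<in>V. of_int (B v w) * w)"
    "\<And>v. v \<in> V \<Longrightarrow> (\<Sum>w\<in>V. \<bar>B v w\<bar>) \<le> K"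
    using assms(2) unfolding acts_on_span_def by blast
  show ?thesis
    unfolding acts_on_span_def
  proof (intro exI[of _ "\<lambda>v w. A v w + B v w"] ballI conjI)
    fix v assume v: "v \<in> V"
    show "(x + y) * v = (\<Sum>w\<in>V. of_int (A v w + B v w) * w)"
      using A(1)[OF v] B(1)[OF v] by (simp add: sum.distrib algebra_simps)
    have "(\<Sum>w\<in>V. \<bar>A v w + B v w\<bar>) \<le> (\<Sum>w\<in>V. \<bar>A v w\<bar> + \<bar>B v w\<bar>)"
      by (intro sum_mono) (rule abs_triangle_ineq)
    also have "\<dots> \<le> H + K"
      using A(2)[OF v] B(2)[OF v] by (simp add: sum.distrib)
    finally show "(\<Sum>w\<in>V. \<bar>A v w + B v w\<bar>) \<le> H + K" .
  qed
qed

lemma acts_on_span_mult: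
  assumes "acts_on_span V x H" "acts_on_span V y K" "0 \<le> H"
  shows "acts_on_span V (x * y) (H * K)"
proof -
  obtain A where A: "\<And>v. v \<in> V \<Longrightarrow> x * v = (\<Sum>w\<in>V. of_int (A v w) * w)"
    "\<And>v. v \<in> V \<Longrightarrow> (\<Sum>w\<in>V. \<bar>A v w\<bar>) \<le> H"
    using assms(1) unfolding acts_on_span_def by blast
  obtain B where B: "\<And>v. v \<in> V \<Longrightarrow> y * v = (\<Sum>w\<in>V. of_int (B v w) * w)"
    "\<And>v. v \<in> V \<Longrightarrow> (\<Sum>w\<in>V. \<bar>B v w\<bar>) \<le> K"
    using assms(2) unfolding acts_on_span_def by blast
  show ?thesis
    unfolding acts_on_span_def
  proof (intro exI[of _ "\<lambda>v u. \<Sum>w\<in>V. B v w * A w u"] ballI conjI)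
    fix v assume v: "v \<in> V"
    have "x * y * v = (\<Sum>w\<in>V. of_int (B v w) * (x * w))"
      using arg_cong[OF B(1)[OF v], of "\<lambda>t. x * t"] by (simp add: sum_distrib_left mult_ac)
    also have "\<dots> = (\<Sum>w\<in>V. \<Sum>u\<in>V. of_int (B v w * A w u) * u)"
      by (intro sum.cong refl) (simp only: A(1) sum_distrib_left of_int_mult mult.assoc)
    also have "\<dots> = (\<Sum>u\<in>V. of_int (\<Sum>w\<in>V. B v w * A w u) * u)"
      by (subst sum.swap) (simp add: sum_distrib_right)
    finally show "x * y * v = (\<Sum>u\<in>V. of_int (\<Sum>w\<in>V. B v w * A w u) * u)" .
    have "(\<Sum>u\<in>V. \<bar>\<Sum>w\<in>V. B v w * A w u\<bar>) \<le> (\<Sum>u\<in>V. \<Sum>w\<in>V. \<bar>B v w\<bar> * \<bar>A w u\<bar>)"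
      by (intro sum_mono order_trans[OF sum_abs]) (simp add: abs_mult)
    also have "\<dots> = (\<Sum>w\<in>V. \<bar>B v w\<bar> * (\<Sum>u\<in>V. \<bar>A w u\<bar>))"
      by (subst sum.swap) (simp add: sum_distrib_left)
    also have "\<dots> \<le> (\<Sum>w\<in>V. \<bar>B v w\<bar> * H)"
      by (intro sum_mono mult_left_mono A(2)) auto
    also have "\<dots> = H * (\<Sum>w\<in>V. \<bar>B v w\<bar>)"
      by (simp add: sum_distrib_left mult.commute)
    also have "\<dots> \<le> H * K"
      using B(2)[OF v] assms(3) by (intro mult_left_mono)
    finally show "(\<Sum>u\<in>V. \<bar>\<Sum>w\<in>V. B v w * A w u\<bar>) \<le> H * K" .
  qed
qed

lemma acts_on_span_sum:
  assumes "finite V" "\<And>i. i \<in> I \<Longrightarrow> acts_on_span V (f i) (h i)"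
  shows "acts_on_span V (\<Sum>i\<in>I. f i) (\<Sum>i\<in>I. h i)"
  using assms(2)
proof (induction I rule: infinite_finite_induct)
  case (insert i I)
  then show ?case by (auto intro: acts_on_span_add)
qed (use acts_on_span_of_int[OF assms(1), of 0] in auto)

text \<open>
  The products \<open>v w\<close> generate a module on which both the multipliers that preserve the span of \<open>V\<close>
  and those that preserve the span of \<open>W\<close> act. This replaces the construction of a number field
  that contains several given algebraic numbers.
\<close>

lemma product_stable:
  assumes "finite V" "finite W" "\<And>v. v \<in> V \<Longrightarrow> x * v \<in> int_span V"
    and "u \<in> (\<lambda>(v, w). v * w) ` (V \<times> W)"
  shows "x * u \<in> int_span ((\<lambda>(v, w). v * w) ` (V \<times> W))" (is "_ \<in> int_span ?VW")
proof -
  obtain v w where vw: "v \<in> V" "w \<in> W" "u = v * w" using assms(4) by auto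
  obtain a where a: "x * v = (\<Sum>t\<in>V. of_int (a t) * t)"
    using assms(3)[OF vw(1)] unfolding int_span_def by blast
  have "x * u = (\<Sum>t\<in>V. of_int (a t) * t) * w"
    unfolding a[symmetric] by (simp add: vw(3))
  also have "\<dots> = (\<Sum>t\<in>V. of_int (a t) * (t * w))"
    by (simp add: sum_distrib_right mult.assoc)
  also have "\<dots> \<in> int_span ?VW"
    using assms vw by (intro int_span_sum int_span_scale int_span_base) auto
  finally show ?thesis .
qed

text \<open>
  If \<open>V\<close> is finite and contains a nonzero number, then \<open>c x\<close> is an algebraic integer, a root of the
  characteristic polynomial of a matrix of its action;
  \<open>c\<close> is a denominator of \<open>x\<close>.
\<close>

definition integral_over :: "real set \<Rightarrow> nat \<Rightarrow> real \<Rightarrow> bool"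
  where "integral_over V c x \<longleftrightarrow> (\<forall>v\<in>V. real c * x * v \<in> int_span V)"

lemma integral_over_product:
  assumes "finite V" "finite W"
  shows integral_over_product_left:
      "integral_over V c x \<Longrightarrow> integral_over ((\<lambda>(v, w). v * w) ` (V \<times> W)) (c * d) x"
    and integral_over_product_right:
      "integral_over W d x \<Longrightarrow> integral_over ((\<lambda>(v, w). v * w) ` (V \<times> W)) (c * d) x"
proof -
  have L: "integral_over ((\<lambda>(v, w). v * w) ` (V \<times> W)) (c * d) x"
    if "integral_over V c x" "finite V" "finite W" for V W c d
    unfolding integral_over_def
  proof
    fix u assume "u \<in> (\<lambda>(v, w). v * w) ` (V \<times> W)"
    then have "real c * x * u \<in> int_span ((\<lambda>(v, w). v * w) ` (V \<times> W))"
      using that by (intro product_stable) (auto simp: integral_over_def)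
    then have "of_int (int d) * (real c * x * u) \<in> int_span ((\<lambda>(v, w). v * w) ` (V \<times> W))"
      by (rule int_span_scale)
    then show "real (c * d) * x * u \<in> int_span ((\<lambda>(v, w). v * w) ` (V \<times> W))"
      by (simp add: mult_ac)
  qed
  show "integral_over V c x \<Longrightarrow> integral_over ((\<lambda>(v, w). v * w) ` (V \<times> W)) (c * d) x"
    using L assms by blast
  have "(\<lambda>(v, w). v * w) ` (V \<times> W) = (\<lambda>(v, w). v * w) ` (W \<times> V)"
    by (force simp: image_iff mult.commute)
  then show "integral_over W d x \<Longrightarrow> integral_over ((\<lambda>(v, w). v * w) ` (V \<times> W)) (c * d) x"
    using L[of W d V c] assms by (simp add: mult.commute)
qed

text \<open>
  Simultaneous algebraicity of all members of \<open>X\<close>, with one lattice and one denominator for all of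
  them. In this form algebraicity passes to products directly, and a single matrix size \<open>card V\<close>
  controls the Liouville bound for all polynomial expressions in \<open>X\<close>.
\<close>

definition lattice_algebraic :: "real set \<Rightarrow> bool"
  where "lattice_algebraic X \<longleftrightarrow>
    (\<exists>V c. finite V \<and> (\<exists>v\<in>V. v \<noteq> 0) \<and> 0 < c \<and> (\<forall>x\<in>X. integral_over V c x))"

lemma lattice_algebraic_empty: "lattice_algebraic {}"
  unfolding lattice_algebraic_def by (intro exI[of _ "{1}"] exI[of _ "1::nat"]) auto

lemma lattice_algebraic_Un:
  assumes "lattice_algebraic X" "lattice_algebraic Y"
  shows "lattice_algebraic (X \<union> Y)"
proof -
  obtain V c where V: "finite V" "\<exists>v\<in>V. v \<noteq> 0" "0 < c" "\<forall>x\<in>X. integral_over V c x"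
    using assms(1) unfolding lattice_algebraic_def by blast
  obtain W d where W: "finite W" "\<exists>w\<in>W. w \<noteq> 0" "0 < d" "\<forall>x\<in>Y. integral_over W d x"
    using assms(2) unfolding lattice_algebraic_def by blast
  obtain v w where "v \<in> V" "w \<in> W" "v \<noteq> 0" "w \<noteq> 0" using V W by blast
  then have "\<exists>u\<in>(\<lambda>(v, w). v * w) ` (V \<times> W). u \<noteq> 0"
    by (intro bexI[of _ "v * w"]) auto
  moreover have "\<forall>x\<in>X \<union> Y. integral_over ((\<lambda>(v, w). v * w) ` (V \<times> W)) (c * d) x"
    using V W integral_over_product_left[OF V(1) W(1)] integral_over_product_right[OF V(1) W(1)]
    by blast
  ultimately show ?thesis
    unfolding lattice_algebraic_def using V W
    by (intro exI[of _ "(\<lambda>(v, w). v * w) ` (V \<times> W)"] exI[of _ "c * d"]) auto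
qed

lemma lattice_algebraic_finite:
  assumes "finite X" "\<And>x. x \<in> X \<Longrightarrow> lattice_algebraic {x}"
  shows "lattice_algebraic X"
  using assms
proof (induction X rule: finite_induct)
  case (insert x X)
  then have "lattice_algebraic ({x} \<union> X)" by (intro lattice_algebraic_Un) auto
  then show ?case by simp
qed (rule lattice_algebraic_empty)

lemma lattice_algebraic_mult:
  assumes "lattice_algebraic {x}" "lattice_algebraic {y}"
  shows "lattice_algebraic {x * y}"
proof -
  have "lattice_algebraic {x, y}"
    using lattice_algebraic_Un[OF assms] by (simp add: insert_commute)
  then obtain V c where V: "finite V" "\<exists>v\<in>V. v \<noteq> 0" "0 < c" "integral_over V c x" "integral_over V c y"
    unfolding lattice_algebraic_def by auto
  obtain H where H: "acts_on_span V (real c * x) H"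
    using acts_on_span_iff_stable[OF V(1), of "real c * x"] V(4) unfolding integral_over_def by auto
  obtain K where K: "acts_on_span V (real c * y) K"
    using acts_on_span_iff_stable[OF V(1), of "real c * y"] V(5) unfolding integral_over_def by auto
  have "acts_on_span V (real c * x * (real c * y)) (\<bar>H\<bar> * K)"
    by (rule acts_on_span_mult[OF acts_on_span_mono[OF H] K]) auto
  then have "\<forall>v\<in>V. real c * x * (real c * y) * v \<in> int_span V"
    using acts_on_span_iff_stable[OF V(1)] by blast
  then have "integral_over V (c * c) (x * y)"
    unfolding integral_over_def by (simp add: mult_ac)
  then show ?thesis
    unfolding lattice_algebraic_def using V by (intro exI[of _ V] exI[of _ "c * c"]) auto
qed

text \<open>
  If \<open>a\<^sub>n x\<^sup>n + \<dots> + a\<^sub>0 = 0\<close>, then \<open>a\<^sub>n x\<close> is integral: the first \<open>n\<close> powers of \<open>a\<^sub>n x\<close> generate a module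
  that it maps to itself.
\<close>

lemma lattice_algebraic_of_algebraic:
  assumes "algebraic x"
  shows "lattice_algebraic {x}"
proof -
  obtain p where p: "\<And>i. coeff p i \<in> \<int>" "p \<noteq> 0" "poly p x = 0"
    by (rule algebraicE[OF assms]) (use that in blast)
  define n where "n = degree p"
  obtain a where a: "\<And>i. coeff p i = of_int (a i)"
  proof -
    have "\<forall>i. \<exists>k. coeff p i = of_int k" using p(1) by (auto simp: Ints_def)
    then show ?thesis using that by (auto simp: choice_iff)
  qed
  have an: "a n \<noteq> 0"
    using p(2) a[of n] by (auto simp: n_def)
  have n: "n > 0"
  proof (rule Nat.gr0I)
    assume "n = 0"
    then obtain k where "p = [:k:]" unfolding n_def by (elim degree_eq_zeroE)
    then show False using p by auto
  qed
  define V where "V = (\<lambda>k. of_int (a n) ^ k * x ^ k) ` {..<n}"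
  define c where "c = nat \<bar>a n\<bar>"
  have fin: "finite V" by (simp add: V_def)
  have V: "of_int (a n) ^ k * x ^ k \<in> int_span V" if "k < n" for k
    using that fin by (intro int_span_base) (auto simp: V_def)
  have eq: "of_int (a n) * x ^ n = - (\<Sum>k<n. of_int (a k) * x ^ k)"
  proof -
    have "0 = (\<Sum>k\<le>n. of_int (a k) * x ^ k)"
      using p(3) by (simp add: poly_altdef a n_def)
    also have "\<dots> = (\<Sum>k<n. of_int (a k) * x ^ k) + of_int (a n) * x ^ n"
      by (simp add: lessThan_Suc_atMost[symmetric])
    finally show ?thesis by linarith
  qed
  have st: "of_int (a n) * x * v \<in> int_span V" if "v \<in> V" for v
  proof -
    obtain k where k: "k < n" "v = of_int (a n) ^ k * x ^ k" using \<open>v \<in> V\<close> by (auto simp: V_def)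
    show ?thesis
    proof (cases "Suc k < n")
      case True
      then show ?thesis using V[OF True] k by (simp add: mult_ac)
    next
      case False
      then have nk: "n = Suc k" using k by simp
      have "of_int (a n) * x * v = of_int (a n) ^ k * (of_int (a n) * x ^ n)"
        using k nk by (simp add: mult_ac)
      also have "\<dots> = (\<Sum>j<n. of_int (- a j * a n ^ (k - j)) * (of_int (a n) ^ j * x ^ j))"
        unfolding eq sum_distrib_left sum_negf[symmetric]
      proof (intro sum.cong refl)
        fix j assume "j \<in> {..<n}"
        then have "k = (k - j) + j" using nk by simp
        then have "of_int (a n) ^ k = (of_int (a n) ^ (k - j) * of_int (a n) ^ j :: real)"
          by (metis power_add)
        then show "of_int (a n) ^ k * - (of_int (a j) * x ^ j) =
            of_int (- a j * a n ^ (k - j)) * (of_int (a n) ^ j * x ^ j)"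
          by simp
      qed
      also have "\<dots> \<in> int_span V"
        by (intro int_span_sum int_span_scale V) auto
      finally show ?thesis .
    qed
  qed
  have c: "real c = of_int (sgn (a n) * a n)"
    by (simp add: c_def sgn_if)
  have "real c * x * v \<in> int_span V" if "v \<in> V" for v
  proof -
    \<comment> \<open>The leading coefficient may be negative, but a denominator is a natural number.\<close>
    have "of_int (sgn (a n)) * (of_int (a n) * x * v) \<in> int_span V"
      by (rule int_span_scale[OF st[OF that]])
    then show ?thesis by (simp add: c mult.assoc)
  qed
  then have int: "integral_over V c x" by (simp add: integral_over_def)
  have "of_int (a n) ^ 0 * x ^ 0 \<in> V" unfolding V_def using n by (intro imageI) simp
  then have "1 \<in> V" by (simp only: power_0 mult_1)
  then have "\<exists>v\<in>V. v \<noteq> 0" by (rule bexI[rotated]) simp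
  moreover have "0 < c" using an by (simp add: c_def)
  ultimately show ?thesis
    unfolding lattice_algebraic_def using fin int by blast
qed

section \<open>A Liouville inequality\<close>

text \<open>
  Compare both sides of \<open>A v = k v\<close> in a coordinate where \<open>v\<close> is largest.
\<close>

lemma complex_eigenvalue_norm_le:
  fixes A :: "complex mat"
  assumes A: "A \<in> carrier_mat m m" and "eigenvalue A k"
    and H: "\<And>i. i < m \<Longrightarrow> (\<Sum>j<m. norm (A $$ (i, j))) \<le> H"
  shows "norm k \<le> H"
proof -
  obtain v where v: "v \<in> carrier_vec m" "v \<noteq> 0\<^sub>v m" "A *\<^sub>v v = k \<cdot>\<^sub>v v"
    using assms unfolding eigenvalue_def eigenvector_def by auto
  have "\<exists>i<m. v $ i \<noteq> 0"
    using v(1,2) by (metis carrier_vecD eq_vecI index_zero_vec)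
  then have m: "{..<m} \<noteq> {}" by auto
  obtain i where i: "i < m" "\<And>j. j < m \<Longrightarrow> norm (v $ j) \<le> norm (v $ i)"
  proof -
    let ?M = "Max ((\<lambda>j. norm (v $ j)) ` {..<m})"
    have "?M \<in> (\<lambda>j. norm (v $ j)) ` {..<m}" using m by (intro Max_in) auto
    then obtain i where "i < m" "norm (v $ i) = ?M" by force
    moreover have "norm (v $ j) \<le> ?M" if "j < m" for j
      using that by (intro Max_ge) auto
    ultimately show ?thesis using that by metis
  qed
  have pos: "norm (v $ i) > 0"
  proof -
    obtain j where "j < m" "v $ j \<noteq> 0" using \<open>\<exists>i<m. v $ i \<noteq> 0\<close> by blast
    then have "0 < norm (v $ j)" "norm (v $ j) \<le> norm (v $ i)" using i(2) by auto
    then show ?thesis by linarith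
  qed
  have "k * v $ i = (k \<cdot>\<^sub>v v) $ i" using v(1) i by simp
  also have "\<dots> = (A *\<^sub>v v) $ i" by (simp only: v(3))
  also have "\<dots> = (\<Sum>j<m. A $$ (i, j) * v $ j)"
    using A v(1) i by (auto simp: scalar_prod_def lessThan_atLeast0)
  finally have "norm k * norm (v $ i) = norm (\<Sum>j<m. A $$ (i, j) * v $ j)"
    by (metis norm_mult)
  also have "\<dots> \<le> (\<Sum>j<m. norm (A $$ (i, j)) * norm (v $ i))"
    using i by (intro sum_norm_le) (auto simp: norm_mult intro!: mult_left_mono)
  also have "\<dots> \<le> H * norm (v $ i)"
    unfolding sum_distrib_right[symmetric] using H[OF i(1)] by (intro mult_right_mono) auto
  finally show ?thesis using pos by simp
qed

text \<open>
  The lowest nonzero coefficient of a product of linear factors: the zero roots contribute a power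
  of the variable and the others their constant terms.
\<close>

lemma coeff_prod_linear_factors:
  fixes as :: "complex list"
  shows "coeff (\<Prod>a\<leftarrow>as. [:- a, 1:]) (length (filter (\<lambda>a. a = 0) as))
    = (\<Prod>a\<leftarrow>filter (\<lambda>a. a \<noteq> 0) as. - a)"
proof -
  have "(\<Prod>a\<leftarrow>as. [:- a, 1:]) = monom 1 (length (filter (\<lambda>a. a = 0) as)) *
      (\<Prod>a\<leftarrow>filter (\<lambda>a. a \<noteq> 0) as. [:- a, 1:])"
  proof (induction as)
    case (Cons a as)
    have X: "[:- 0, 1:] * monom 1 k = monom (1::complex) (Suc k)" for k
      by (simp add: monom_Suc)
    show ?case
    proof (cases "a = 0")
      case True
      then show ?thesis
        by (simp only: list.map prod_list.Cons Cons.IH filter.simps if_True length_Cons X[symmetric]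
            mult.assoc not_False_eq_True simp_thms if_False)
    next
      case False
      then show ?thesis
        by (simp only: list.map prod_list.Cons Cons.IH filter.simps if_True if_False not_False_eq_True
            mult.left_commute)
    qed
  qed (simp add: monom_0)
  moreover have "coeff (\<Prod>a\<leftarrow>bs. [:- a, 1:]) 0 = (\<Prod>a\<leftarrow>bs. - a)" for bs :: "complex list"
    by (induction bs) (auto simp: coeff_mult_0)
  ultimately show ?thesis
    by (simp add: coeff_monom_mult)
qed

lemma norm_prod_list_le:
  fixes as :: "complex list"
  assumes "x \<in> set as" "\<And>a. a \<in> set as \<Longrightarrow> norm a \<le> H" "1 \<le> H"
  shows "norm (\<Prod>a\<leftarrow>as. - a) \<le> norm x * H ^ length as"
proof -
  have le: "norm (\<Prod>a\<leftarrow>bs. - a) \<le> H ^ length bs" if "set bs \<subseteq> set as" for bs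
    using that
    by (induction bs) (use assms in \<open>auto simp: norm_mult intro!: mult_mono\<close>)
  obtain ys zs where as: "as = ys @ x # zs" using assms(1) by (meson split_list)
  have "norm (\<Prod>a\<leftarrow>as. - a) = norm x * norm (\<Prod>a\<leftarrow>ys @ zs. - a)"
    by (simp add: as norm_mult)
  also have "\<dots> \<le> norm x * H ^ length (ys @ zs)"
    by (intro mult_left_mono le) (auto simp: as)
  also have "\<dots> \<le> norm x * H ^ length as"
    using assms(3) by (intro mult_left_mono power_increasing) (auto simp: as)
  finally show ?thesis .
qed

text \<open>
  Liouville's inequality. The number \<open>x\<close> is an eigenvalue of an integer matrix all of whose
  eigenvalues have absolute value at most \<open>H\<close>. The product of its nonzero eigenvalues is, up to
  sign, the lowest nonzero coefficient of the characteristic polynomial, hence a nonzero integer; it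
  has absolute value at least 1, and \<open>x\<close> is one of its factors.
\<close>

lemma liouville_bound:
  assumes V: "finite V" "v0 \<in> V" "v0 \<noteq> 0"
    and x: "acts_on_span V x H" "x \<noteq> 0" and H: "1 \<le> H"
  shows "1 \<le> \<bar>x\<bar> * of_int H ^ card V"
proof -
  obtain A where A: "\<And>v. v \<in> V \<Longrightarrow> x * v = (\<Sum>w\<in>V. of_int (A v w) * w)"
    "\<And>v. v \<in> V \<Longrightarrow> (\<Sum>w\<in>V. \<bar>A v w\<bar>) \<le> H"
    using x(1) unfolding acts_on_span_def by blast
  define m where "m = card V"
  obtain f where f: "bij_betw f {..<m} V"
    using ex_bij_betw_nat_finite[OF V(1)] by (auto simp: m_def lessThan_atLeast0)
  have fV: "f i \<in> V" if "i < m" for i using f that by (auto simp: bij_betw_def)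
  define B where "B = mat m m (\<lambda>(i, j). A (f i) (f j))"
  define C where "C = map_mat (of_int :: int \<Rightarrow> complex) B"
  define w where "w = vec m (\<lambda>i. complex_of_real (f i))"
  have B: "B \<in> carrier_mat m m" by (simp add: B_def)
  have C: "C \<in> carrier_mat m m" by (simp add: C_def B_def)
  have re: "(\<Sum>j<m. g (f j)) = (\<Sum>v\<in>V. g v)" for g :: "real \<Rightarrow> 'c::comm_monoid_add"
    by (rule sum.reindex_bij_betw[OF f])
  have "eigenvector C w (complex_of_real x)"
    unfolding eigenvector_def
  proof (intro conjI)
    show "w \<in> carrier_vec (dim_row C)" using C by (simp add: w_def)
    obtain i where i: "i < m" "f i = v0" using f V by (auto simp: bij_betw_def)
    then have "w $ i \<noteq> 0" using V by (simp add: w_def)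
    then show "w \<noteq> 0\<^sub>v (dim_row C)" using i C by auto
    show "C *\<^sub>v w = complex_of_real x \<cdot>\<^sub>v w"
    proof (rule eq_vecI)
      fix i assume "i < dim_vec (complex_of_real x \<cdot>\<^sub>v w)"
      then have i: "i < m" by (simp add: w_def)
      have "(C *\<^sub>v w) $ i = (\<Sum>j<m. complex_of_real (of_int (A (f i) (f j)) * f j))"
        using i by (simp add: C_def B_def w_def scalar_prod_def lessThan_atLeast0)
      also have "\<dots> = complex_of_real (\<Sum>v\<in>V. of_int (A (f i) v) * v)"
        by (simp only: of_real_sum[symmetric] re[of "\<lambda>v. of_int (A (f i) v) * v"])
      also have "\<dots> = complex_of_real (x * f i)" using A(1)[OF fV[OF i]] by simp
      also have "\<dots> = (complex_of_real x \<cdot>\<^sub>v w) $ i" using i by (simp add: w_def)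
      finally show "(C *\<^sub>v w) $ i = (complex_of_real x \<cdot>\<^sub>v w) $ i" .
    qed (use C in \<open>simp add: w_def\<close>)
  qed
  then have ev: "eigenvalue C (complex_of_real x)" unfolding eigenvalue_def by blast
  obtain as where as: "char_poly C = (\<Prod>a\<leftarrow>as. [:- a, 1:])" "length as = m"
    using char_poly_factorized[OF C] by blast
  have roots: "poly (char_poly C) k = 0 \<longleftrightarrow> k \<in> set as" for k
    unfolding as(1) by (induction as) auto
  have xas: "complex_of_real x \<in> set as"
    using ev eigenvalue_root_char_poly[OF C] roots by blast
  have le: "norm a \<le> of_int H" if "a \<in> set as" for a
  proof (rule complex_eigenvalue_norm_le[OF C])
    show "eigenvalue C a" using that eigenvalue_root_char_poly[OF C] roots by blast
    fix i assume i: "i < m"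
    have "(\<Sum>j<m. norm (C $$ (i, j))) = (\<Sum>j<m. of_int \<bar>A (f i) (f j)\<bar>)"
      using i by (intro sum.cong) (auto simp: C_def B_def)
    also have "\<dots> = of_int (\<Sum>v\<in>V. \<bar>A (f i) v\<bar>)"
      by (simp only: of_int_sum[symmetric] re[of "\<lambda>v. \<bar>A (f i) v\<bar>"])
    also have "\<dots> \<le> of_int H" using A(2)[OF fV[OF i]] by linarith
    finally show "(\<Sum>j<m. norm (C $$ (i, j))) \<le> of_int H" .
  qed
  define bs where "bs = filter (\<lambda>a. a \<noteq> 0) as"
  define k where "k = length (filter (\<lambda>a. a = 0) as)"
  have "char_poly C = map_poly of_int (char_poly B)"
    unfolding C_def by (rule of_int_hom.char_poly_hom[OF B])
  then have "(\<Prod>a\<leftarrow>bs. - a) = of_int (coeff (char_poly B) k)"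
    using coeff_prod_linear_factors[of as] as(1) by (simp add: bs_def k_def coeff_map_poly)
  moreover have "(\<Prod>a\<leftarrow>bs. - a) \<noteq> 0"
    unfolding bs_def by (induction as) auto
  ultimately have "1 \<le> norm (\<Prod>a\<leftarrow>bs. - a)"
    by (simp add: norm_of_int) 
  also have "\<dots> \<le> norm (complex_of_real x) * of_int H ^ length bs"
    using H x xas le by (intro norm_prod_list_le) (auto simp: bs_def)
  also have "\<dots> \<le> norm (complex_of_real x) * of_int H ^ card V"
    using H as(2) by (intro mult_left_mono power_increasing) (auto simp: bs_def m_def simp flip: as(2)[unfolded m_def])
  finally show ?thesis by simp
qed

section \<open>Real zeros of exponential polynomials\<close>

text \<open>
  Rolle's theorem puts a zero of the derivative strictly between any two neighbouring zeros.
\<close>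

lemma card_zeros_le_card_deriv_zeros:
  fixes f f' :: "real \<Rightarrow> real"
  assumes deriv: "\<And>x. (f has_real_derivative f' x) (at x)"
    and Z: "finite Z" "\<And>z. z \<in> Z \<Longrightarrow> f z = 0"
    and fin: "finite {x. f' x = 0}"
  shows "card Z \<le> card {x. f' x = 0} + 1"
proof (cases "Z = {}")
  case False
  define next_zero where "next_zero z = Min {w \<in> Z. z < w}" for z
  have next_in: "next_zero z \<in> Z \<and> z < next_zero z" if "z \<in> Z - {Max Z}" for z
  proof -
    have "z < Max Z" using that Z Max_ge[of Z z] by (simp add: less_le)
    then have "{w \<in> Z. z < w} \<noteq> {}" using Max_in[OF Z(1) False] by blast
    then have "next_zero z \<in> {w \<in> Z. z < w}"
      unfolding next_zero_def using Z(1) by (intro Min_in) auto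
    then show ?thesis by blast
  qed
  have "\<exists>\<xi>. z < \<xi> \<and> \<xi> < next_zero z \<and> f' \<xi> = 0" if z: "z \<in> Z - {Max Z}" for z
  proof -
    have "\<exists>\<xi>. z < \<xi> \<and> \<xi> < next_zero z \<and> DERIV f \<xi> :> 0"
    proof (rule Rolle)
      show "continuous_on {z..next_zero z} f"
        by (meson DERIV_isCont continuous_at_imp_continuous_on deriv)
      show "f differentiable (at x)" for x
        using deriv real_differentiable_def by blast
    qed (use next_in[OF z] z Z in auto)
    then show ?thesis using deriv DERIV_unique by metis
  qed
  then obtain \<xi> where \<xi>: "\<And>z. z \<in> Z - {Max Z} \<Longrightarrow> z < \<xi> z \<and> \<xi> z < next_zero z \<and> f' (\<xi> z) = 0"
    by metis
  have less: "\<xi> z < \<xi> w" if "z \<in> Z - {Max Z}" "w \<in> Z - {Max Z}" "z < w" for z w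
  proof -
    have "next_zero z \<le> w"
      unfolding next_zero_def using that Z by (intro Min_le) auto
    then show ?thesis using \<xi>[OF that(1)] \<xi>[OF that(2)] by linarith
  qed
  have "inj_on \<xi> (Z - {Max Z})"
    by (rule inj_onI) (metis less less_irrefl linorder_neqE_linordered_idom)
  then have "card (Z - {Max Z}) \<le> card {x. f' x = 0}"
    using \<xi> fin by (intro card_inj_on_le[where f = \<xi>]) auto
  then show ?thesis using Z(1) False by (simp add: card_Diff_singleton)
qed simp

text \<open>
  The number of real zeros is less than the number of coefficients. Multiplying by \<open>exp (- \<omega>\<^sub>0 x)\<close> moves
  one frequency to 0, and differentiating then lowers the degree of its polynomial by one but leaves
  the other degrees unchanged; by Rolle's theorem at most one zero is lost.
\<close>

theorem exponential_polynomial_card_zeros: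
  fixes W :: "real set" and P :: "real \<Rightarrow> real poly"
  assumes "finite W" "W \<noteq> {}" "\<And>\<omega>. \<omega> \<in> W \<Longrightarrow> P \<omega> \<noteq> 0"
  defines "Z \<equiv> {x. (\<Sum>\<omega>\<in>W. poly (P \<omega>) x * exp (\<omega> * x)) = 0}"
  shows "finite Z \<and> card Z < (\<Sum>\<omega>\<in>W. degree (P \<omega>) + 1)"
  using assms(1-3) unfolding Z_def
proof (induction "\<Sum>\<omega>\<in>W. degree (P \<omega>) + 1" arbitrary: W P rule: less_induct)
  case less
  define Z where "Z = {x. (\<Sum>\<omega>\<in>W. poly (P \<omega>) x * exp (\<omega> * x)) = 0}"
  obtain \<omega>0 where \<omega>0: "\<omega>0 \<in> W" using less.prems by blast
  define D where "D \<omega> = pderiv (P \<omega>) + Polynomial.smult (\<omega> - \<omega>0) (P \<omega>)" for \<omega>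
  define g where "g x = (\<Sum>\<omega>\<in>W. poly (P \<omega>) x * exp ((\<omega> - \<omega>0) * x))" for x
  define g' where "g' x = (\<Sum>\<omega>\<in>W. poly (D \<omega>) x * exp ((\<omega> - \<omega>0) * x))" for x
  have shift: "(\<Sum>\<omega>\<in>W. poly (Q \<omega>) x * exp (\<omega> * x)) =
      exp (\<omega>0 * x) * (\<Sum>\<omega>\<in>W. poly (Q \<omega>) x * exp ((\<omega> - \<omega>0) * x))" for Q :: "real \<Rightarrow> real poly" and x
    unfolding sum_distrib_left
    by (intro sum.cong refl) (simp add: exp_add[symmetric] algebra_simps)
  have Zg: "Z = {x. g x = 0}" unfolding Z_def shift g_def by simp
  have deriv: "(g has_real_derivative g' x) (at x)" for x
    unfolding g_def g'_def
    by (auto intro!: derivative_eq_intros sum.cong simp: D_def algebra_simps)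
  define h where "h \<omega> = (if D \<omega> = 0 then 0 else degree (D \<omega>) + 1)" for \<omega>
  define W' where "W' = {\<omega> \<in> W. D \<omega> \<noteq> 0}"
  have h0: "h \<omega>0 = degree (P \<omega>0)"
    using less.prems(3)[OF \<omega>0]
    by (auto simp: h_def D_def pderiv_eq_0_iff degree_pderiv)
  have h: "h \<omega> = degree (P \<omega>) + 1" if "\<omega> \<in> W" "\<omega> \<noteq> \<omega>0" for \<omega>
  proof (cases "degree (P \<omega>) = 0")
    case True
    then have "D \<omega> = Polynomial.smult (\<omega> - \<omega>0) (P \<omega>)" using pderiv_eq_0_iff by (auto simp: D_def)
    then show ?thesis using that less.prems(3) by (auto simp: h_def)
  next
    case False
    then have "degree (D \<omega>) = degree (P \<omega>)"
      using that unfolding D_def by (subst degree_add_eq_right) (auto simp: degree_pderiv)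
    then show ?thesis using False by (auto simp: h_def)
  qed
  have "(\<Sum>\<omega>\<in>W'. degree (D \<omega>) + 1) = (\<Sum>\<omega>\<in>W. h \<omega>)"
    unfolding W'_def h_def using less.prems(1)
    by (intro sum.mono_neutral_cong_left) auto
  also have "\<dots> = h \<omega>0 + (\<Sum>\<omega>\<in>W - {\<omega>0}. h \<omega>)"
    using less.prems(1) \<omega>0 by (rule sum.remove)
  also have "\<dots> + 1 = (degree (P \<omega>0) + 1) + (\<Sum>\<omega>\<in>W - {\<omega>0}. degree (P \<omega>) + 1)"
    using h h0 by simp
  also have "\<dots> = (\<Sum>\<omega>\<in>W. degree (P \<omega>) + 1)"
    using less.prems(1) \<omega>0 by (rule sum.remove[symmetric])
  finally have count: "(\<Sum>\<omega>\<in>W'. degree (D \<omega>) + 1) + 1 = (\<Sum>\<omega>\<in>W. degree (P \<omega>) + 1)" .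
  have "finite Z \<and> card Z < (\<Sum>\<omega>\<in>W. degree (P \<omega>) + 1)"
  proof (cases "W' = {}")
    case True
    then have W: "W = {\<omega>0}" using h \<omega>0 by (force simp: W'_def h_def)
    then have "degree (P \<omega>0) = 0" using True h0 by (auto simp: W'_def h_def)
    then obtain k where "P \<omega>0 = [:k:]" by (auto elim: degree_eq_zeroE)
    then have "Z = {}" using W less.prems(3)[OF \<omega>0] by (auto simp: Z_def)
    then show ?thesis using count by simp
  next
    case False
    have "finite {x. (\<Sum>\<omega>\<in>W'. poly (D \<omega>) x * exp (\<omega> * x)) = 0} \<and>
      card {x. (\<Sum>\<omega>\<in>W'. poly (D \<omega>) x * exp (\<omega> * x)) = 0} < (\<Sum>\<omega>\<in>W'. degree (D \<omega>) + 1)"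
      using count False less.prems(1) by (intro less.hyps) (auto simp: W'_def)
    moreover have "(\<Sum>\<omega>\<in>W'. poly (D \<omega>) x * exp (\<omega> * x)) = (\<Sum>\<omega>\<in>W. poly (D \<omega>) x * exp (\<omega> * x))" for x
      unfolding W'_def using less.prems(1) by (intro sum.mono_neutral_left) auto
    ultimately have fin: "finite {x. g' x = 0}"
      and card: "card {x. g' x = 0} < (\<Sum>\<omega>\<in>W'. degree (D \<omega>) + 1)"
      by (simp_all add: shift g'_def)
    have bound: "card Y < (\<Sum>\<omega>\<in>W. degree (P \<omega>) + 1)" if "finite Y" "Y \<subseteq> Z" for Y
      using card_zeros_le_card_deriv_zeros[OF deriv that(1) _ fin] that(2) card count
      by (fastforce simp: Zg)
    then have "finite Z"
      using infinite_arbitrarily_large by (metis less_irrefl)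
    then show ?thesis using bound by blast
  qed
  then show ?case by (simp add: Z_def)
qed

section \<open>Integral combinations with small Taylor coefficients\<close>

text \<open>
  The pigeonhole principle of Thue and Siegel. There are \<open>G ^ card \<Lambda>\<close> vectors with coefficients in
  \<open>{0..<G}\<close>; cutting the range of each of the \<open>T\<close> forms into \<open>G ^ K\<close> intervals gives only \<open>G ^ (K T)\<close>
  boxes. Two vectors in the same box have the required difference.
\<close>

lemma small_linear_forms:
  fixes c :: "'l \<Rightarrow> nat \<Rightarrow> real"
  assumes fin: "finite \<Lambda>" and card: "(K + 1) * T \<le> card \<Lambda>" and T: "0 < T" and G: "2 \<le> G"
    and c: "\<And>l k. l \<in> \<Lambda> \<Longrightarrow> k < T \<Longrightarrow> \<bar>c l k\<bar> \<le> M" and M: "0 < M"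
  obtains x :: "'l \<Rightarrow> int" where "\<exists>l\<in>\<Lambda>. x l \<noteq> 0" "\<And>l. l \<in> \<Lambda> \<Longrightarrow> \<bar>x l\<bar> \<le> int G"
    "\<And>k. k < T \<Longrightarrow> \<bar>\<Sum>l\<in>\<Lambda>. of_int (x l) * c l k\<bar> * real G ^ K \<le> 2 * real (card \<Lambda>) * real G * M"
proof -
  define S where "S = real (card \<Lambda>) * real G * M"
  define form where "form a k = (\<Sum>l\<in>\<Lambda>. real (a l) * c l k)" for a :: "'l \<Rightarrow> nat" and k
  \<comment> \<open>Adding \<open>S\<close> makes the forms positive; the strict bound \<open>\<bar>form a k\<bar> < S\<close> keeps the index below \<open>G ^ K\<close>.\<close>
  define box where "box a = (\<lambda>k\<in>{..<T}. nat \<lfloor>(form a k + S) / (2 * S) * real G ^ K\<rfloor>)" for a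
  define D where "D = PiE \<Lambda> (\<lambda>_. {..<G})"
  have L: "0 < card \<Lambda>" using card T by (cases "card \<Lambda>") auto
  then have S: "0 < S" using G M by (simp add: S_def)
  have form: "\<bar>form a k\<bar> < S" if "a \<in> D" "k < T" for a k
  proof -
    have "\<bar>form a k\<bar> \<le> (\<Sum>l\<in>\<Lambda>. \<bar>real (a l) * c l k\<bar>)" unfolding form_def by (rule sum_abs)
    also have "\<dots> \<le> (\<Sum>l\<in>\<Lambda>. real (G - 1) * M)"
    proof (rule sum_mono)
      fix l assume "l \<in> \<Lambda>"
      then have "a l < G" using \<open>a \<in> D\<close> by (auto simp: D_def)
      then show "\<bar>real (a l) * c l k\<bar> \<le> real (G - 1) * M"
        using c[OF \<open>l \<in> \<Lambda>\<close> that(2)] by (auto simp: abs_mult intro!: mult_mono)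
    qed
    also have "\<dots> = real (card \<Lambda>) * (real (G - 1) * M)" by simp
    also have "\<dots> < real (card \<Lambda>) * (real G * M)"
      using L G M by (intro mult_strict_left_mono mult_strict_right_mono) auto
    finally show ?thesis by (simp add: S_def mult.assoc)
  qed
  have GK: "0 < real G ^ K" using G by simp
  have "box ` D \<subseteq> PiE {..<T} (\<lambda>_. {..<G ^ K})"
  proof (rule image_subsetI)
    fix a assume a: "a \<in> D"
    have "nat \<lfloor>(form a k + S) / (2 * S) * real G ^ K\<rfloor> < G ^ K" if "k < T" for k
    proof -
      have "(form a k + S) / (2 * S) < 1" "0 \<le> (form a k + S) / (2 * S)"
        using form[OF a that] S by (auto simp: field_simps)
      then have "(form a k + S) / (2 * S) * real G ^ K < 1 * real G ^ K"
        using GK by (intro mult_strict_right_mono)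
      then have "(form a k + S) / (2 * S) * real G ^ K < real (G ^ K)" by simp
      then have "\<lfloor>(form a k + S) / (2 * S) * real G ^ K\<rfloor> < int (G ^ K)"
        by (simp only: floor_less_iff of_int_of_nat_eq)
      moreover have "0 < G ^ K" using G by simp
      ultimately show ?thesis by linarith
    qed
    then show "box a \<in> PiE {..<T} (\<lambda>_. {..<G ^ K})" by (auto simp: box_def)
  qed
  then have "card (box ` D) \<le> card (PiE {..<T} (\<lambda>_. {..<G ^ K}))"
    by (intro card_mono finite_PiE) auto
  also have "\<dots> = G ^ (K * T)" by (simp add: card_PiE power_mult)
  also have "\<dots> < G ^ card \<Lambda>"
    using card T G by (intro power_strict_increasing) auto
  also have "\<dots> = card D" using fin by (simp add: D_def card_PiE)
  finally have "\<not> inj_on box D" by (rule pigeonhole)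
  then obtain a b where ab: "a \<in> D" "b \<in> D" "a \<noteq> b" "box a = box b"
    by (auto simp: inj_on_def)
  define x where "x l = int (a l) - int (b l)" for l
  show thesis
  proof (rule that[of x])
    have "\<exists>l\<in>\<Lambda>. a l \<noteq> b l"
      using ab PiE_ext[of a \<Lambda> "\<lambda>_. {..<G}" b] unfolding D_def by blast
    then show "\<exists>l\<in>\<Lambda>. x l \<noteq> 0" by (auto simp: x_def)
    show "\<bar>x l\<bar> \<le> int G" if "l \<in> \<Lambda>" for l
    proof -
      have "a l < G" "b l < G" using that ab by (auto simp: D_def)
      then show ?thesis by (auto simp: x_def)
    qed
    show "\<bar>\<Sum>l\<in>\<Lambda>. of_int (x l) * c l k\<bar> * real G ^ K \<le> 2 * real (card \<Lambda>) * real G * M"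
      if k: "k < T" for k
    proof -
      define u where "u a = (form a k + S) / (2 * S) * real G ^ K" for a
      have nonneg: "0 \<le> u a" if "a \<in> D" for a
        using form[OF that k] S GK by (auto simp: u_def)
      have "nat \<lfloor>u a\<rfloor> = nat \<lfloor>u b\<rfloor>"
        using fun_cong[OF ab(4), of k] k by (simp add: box_def u_def)
      then have "\<lfloor>u a\<rfloor> = \<lfloor>u b\<rfloor>"
        using nonneg ab(1,2) by (metis eq_nat_nat_iff zero_le_floor)
      then have "\<bar>u a - u b\<bar> \<le> 1" by linarith
      moreover have "u a - u b = (form a k - form b k) * real G ^ K / (2 * S)"
        by (simp add: u_def diff_divide_distrib[symmetric] left_diff_distrib[symmetric])
      ultimately have "\<bar>form a k - form b k\<bar> * real G ^ K \<le> 2 * S"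
        using S GK by (simp add: abs_mult)
      moreover have "form a k - form b k = (\<Sum>l\<in>\<Lambda>. of_int (x l) * c l k)"
        by (simp add: form_def x_def sum_subtractf left_diff_distrib)
      ultimately show ?thesis by (simp add: S_def)
    qed
  qed
qed

text \<open>
  The Taylor coefficients at 0 of \<open>z ^ a * exp (\<omega> * z)\<close>.
\<close>

definition monom_exp_coeff :: "nat \<Rightarrow> real \<Rightarrow> nat \<Rightarrow> real"
  where "monom_exp_coeff a \<omega> k = (if k < a then 0 else \<omega> ^ (k - a) / fact (k - a))"

lemma monom_exp_sums: "(\<lambda>k. monom_exp_coeff a \<omega> k * z ^ k) sums (z ^ a * exp (\<omega> * z))"
proof -
  have "(\<lambda>n. z ^ a * ((\<omega> * z) ^ n /\<^sub>R fact n)) sums (z ^ a * exp (\<omega> * z))"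
    by (intro sums_mult exp_converges)
  also have "(\<lambda>n. z ^ a * ((\<omega> * z) ^ n /\<^sub>R fact n)) = (\<lambda>n. monom_exp_coeff a \<omega> (n + a) * z ^ (n + a))"
    by (simp add: monom_exp_coeff_def power_add power_mult_distrib field_simps)
  finally show ?thesis
    by (subst (asm) sums_zero_iff_shift) (auto simp: monom_exp_coeff_def)
qed

lemma monom_exp_coeff_abs: "\<bar>monom_exp_coeff a \<omega> k\<bar> = monom_exp_coeff a \<bar>\<omega>\<bar> k"
  by (simp add: monom_exp_coeff_def power_abs)

lemma monom_exp_coeff_nonneg: "0 \<le> monom_exp_coeff a \<bar>\<omega>\<bar> k"
  by (simp add: monom_exp_coeff_def)

lemma monom_exp_coeff_le:
  assumes "0 \<le> r"
  shows "\<bar>monom_exp_coeff a \<omega> k * r ^ k\<bar> \<le> r ^ a * exp (\<bar>\<omega>\<bar> * r)"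
proof -
  have "(\<Sum>i\<in>{k}. monom_exp_coeff a \<bar>\<omega>\<bar> i * r ^ i) \<le> suminf (\<lambda>i. monom_exp_coeff a \<bar>\<omega>\<bar> i * r ^ i)"
    using assms monom_exp_sums[of a "\<bar>\<omega>\<bar>" r]
    by (intro sum_le_suminf) (auto simp: sums_iff monom_exp_coeff_nonneg)
  then show ?thesis
    using assms monom_exp_sums[of a "\<bar>\<omega>\<bar>" r] by (simp add: sums_iff abs_mult monom_exp_coeff_abs)
qed

text \<open>
  Doubling the radius gains a factor \<open>2 ^ T\<close> for a remainder that starts at order \<open>T\<close>.
\<close>

lemma monom_exp_taylor_remainder:
  assumes "\<bar>y\<bar> \<le> r"
  shows "\<bar>y ^ a * exp (\<omega> * y) - (\<Sum>k<T. monom_exp_coeff a \<omega> k * y ^ k)\<bar> * 2 ^ T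
    \<le> (2 * r) ^ a * exp (\<bar>\<omega>\<bar> * (2 * r))"
proof -
  let ?c = "monom_exp_coeff a \<omega>" and ?d = "monom_exp_coeff a \<bar>\<omega>\<bar>"
  have r: "0 \<le> r" using assms by linarith
  have d: "summable (\<lambda>k. ?d k * (2 * r) ^ k)" "suminf (\<lambda>k. ?d k * (2 * r) ^ k) = (2 * r) ^ a * exp (\<bar>\<omega>\<bar> * (2 * r))"
    using monom_exp_sums[of a "\<bar>\<omega>\<bar>" "2 * r"] by (simp_all add: sums_iff)
  have le: "norm (?c (k + T) * y ^ (k + T) * 2 ^ T) \<le> ?d (k + T) * (2 * r) ^ (k + T)" for k
  proof -
    have "norm (?c (k + T) * y ^ (k + T) * 2 ^ T) = ?d (k + T) * (\<bar>y\<bar> ^ (k + T) * 2 ^ T)"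
      by (simp add: abs_mult monom_exp_coeff_abs power_abs)
    also have "\<dots> \<le> ?d (k + T) * (r ^ (k + T) * 2 ^ (k + T))"
      using assms r by (intro mult_left_mono mult_mono power_mono power_increasing)
        (auto simp: monom_exp_coeff_nonneg)
    finally show ?thesis by (simp add: power_mult_distrib mult_ac)
  qed
  have sd: "summable (\<lambda>k. ?d (k + T) * (2 * r) ^ (k + T))"
    using d(1) by (subst summable_iff_shift[of "\<lambda>k. ?d k * (2 * r) ^ k"])
  have "(\<lambda>k. ?c (k + T) * y ^ (k + T)) sums (y ^ a * exp (\<omega> * y) - (\<Sum>k<T. ?c k * y ^ k))"
    using monom_exp_sums by (subst sums_iff_shift) simp
  then have "(\<lambda>k. ?c (k + T) * y ^ (k + T) * 2 ^ T) sums
      ((y ^ a * exp (\<omega> * y) - (\<Sum>k<T. ?c k * y ^ k)) * 2 ^ T)"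
    by (rule sums_mult2)
  then have "\<bar>(y ^ a * exp (\<omega> * y) - (\<Sum>k<T. ?c k * y ^ k)) * 2 ^ T\<bar>
      = norm (suminf (\<lambda>k. ?c (k + T) * y ^ (k + T) * 2 ^ T))"
    by (simp add: sums_iff)
  also have "\<dots> \<le> suminf (\<lambda>k. ?d (k + T) * (2 * r) ^ (k + T))"
    using le sd by (rule norm_suminf_le)
  also have "\<dots> \<le> suminf (\<lambda>k. ?d k * (2 * r) ^ k)"
  proof -
    have "suminf (\<lambda>k. ?d k * (2 * r) ^ k) = suminf (\<lambda>k. ?d (k + T) * (2 * r) ^ (k + T)) + (\<Sum>k<T. ?d k * (2 * r) ^ k)"
      using d(1) by (rule suminf_split_initial_segment)
    moreover have "0 \<le> (\<Sum>k<T. ?d k * (2 * r) ^ k)"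
      using r by (intro sum_nonneg) (auto simp: monom_exp_coeff_nonneg)
    ultimately show ?thesis by linarith
  qed
  finally show ?thesis using d(2) by (simp add: abs_mult)
qed

text \<open>
  A nontrivial combination is an exponential polynomial with at most \<open>N * card W\<close> coefficients, so it
  cannot vanish on as many points.
\<close>

lemma exp_poly_combination_nonzero:
  fixes x :: "nat \<times> real \<Rightarrow> int"
  assumes "finite W" "\<exists>l\<in>{..<N} \<times> W. x l \<noteq> 0" "finite Y" "N * card W \<le> card Y"
  obtains y where "y \<in> Y" "(\<Sum>(a, \<omega>)\<in>{..<N} \<times> W. of_int (x (a, \<omega>)) * (y ^ a * exp (\<omega> * y))) \<noteq> 0"
proof -
  define P where "P \<omega> = (\<Sum>a<N. monom (real_of_int (x (a, \<omega>))) a)" for \<omega>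
  define W' where "W' = {\<omega> \<in> W. P \<omega> \<noteq> 0}"
  have coeff: "coeff (P \<omega>) a = (if a < N then of_int (x (a, \<omega>)) else 0)" for \<omega> a
    by (simp add: P_def coeff_sum if_distrib cong: if_cong)
  obtain b \<eta> where "b < N" "\<eta> \<in> W" "x (b, \<eta>) \<noteq> 0" using assms(2) by auto
  moreover from this have "P \<eta> \<noteq> 0" using coeff[of \<eta> b] by auto
  ultimately have W': "W' \<noteq> {}" and N: "0 < N" by (auto simp: W'_def)
  have deg: "degree (P \<omega>) + 1 \<le> N" for \<omega>
  proof -
    have "degree (P \<omega>) \<le> N - 1" by (rule degree_le) (use coeff N in auto)
    then show ?thesis using N by simp
  qed
  define Z where "Z = {y. (\<Sum>\<omega>\<in>W'. poly (P \<omega>) y * exp (\<omega> * y)) = 0}"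
  have "finite Z \<and> card Z < (\<Sum>\<omega>\<in>W'. degree (P \<omega>) + 1)"
    unfolding Z_def using assms(1) W' by (intro exponential_polynomial_card_zeros) (auto simp: W'_def)
  moreover have "(\<Sum>\<omega>\<in>W'. degree (P \<omega>) + 1) \<le> (\<Sum>\<omega>\<in>W'. N)"
    by (rule sum_mono) (rule deg)
  moreover have "card W' \<le> card W" unfolding W'_def using assms(1) by (intro card_mono) auto
  then have "(\<Sum>\<omega>\<in>W'. N) \<le> N * card W" by simp
  ultimately have "\<not> Y \<subseteq> Z" using assms(4) card_mono[of Z Y] by linarith
  then obtain y where y: "y \<in> Y" "(\<Sum>\<omega>\<in>W'. poly (P \<omega>) y * exp (\<omega> * y)) \<noteq> 0"
    by (auto simp: Z_def)
  have "(\<Sum>\<omega>\<in>W'. poly (P \<omega>) y * exp (\<omega> * y)) = (\<Sum>\<omega>\<in>W. poly (P \<omega>) y * exp (\<omega> * y))"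
    unfolding W'_def using assms(1) by (intro sum.mono_neutral_left) auto
  also have "\<dots> = (\<Sum>\<omega>\<in>W. \<Sum>a<N. of_int (x (a, \<omega>)) * (y ^ a * exp (\<omega> * y)))"
    by (simp add: P_def poly_sum poly_monom sum_distrib_right mult.assoc)
  also have "\<dots> = (\<Sum>(a, \<omega>)\<in>{..<N} \<times> W. of_int (x (a, \<omega>)) * (y ^ a * exp (\<omega> * y)))"
    by (subst sum.swap) (simp add: sum.cartesian_product)
  finally show thesis using that y by auto
qed

section \<open>The transcendence argument\<close>

text \<open>
  The transcendence argument. The \<open>L = N * card W\<close> functions \<open>z ^ a * exp (\<omega> * z)\<close> have algebraic values of
  size \<open>Q\<close> on \<open>Y\<close>. As \<open>L\<close> is at least \<open>2 * card V + 4\<close> times \<open>T\<close>, an integral combination \<open>F\<close> with coefficients at most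
  \<open>G\<close> can be found whose first \<open>T\<close> Taylor coefficients, scaled to the radius \<open>r\<close>, are at most
  \<open>G\<^sup>2 / G ^ (2 * card V + 3)\<close>. Then \<open>F\<close> is small on all of \<open>Y\<close>, the Taylor remainder being negligible by the
  hypothesis on \<open>2 ^ T\<close>; but at a point of \<open>Y\<close> where \<open>F\<close> does not vanish, Liouville's inequality forbids a
  value that small. The choice \<open>G = 4 L\<^sup>2 Q\<^sup>2\<close> absorbs every factor \<open>L\<close> and \<open>Q\<close> that turns up
  into a power of \<open>G\<close>.
\<close>

theorem exponential_values_contradiction:
  fixes V W Y :: "real set" and N T Q D :: nat
  assumes V: "finite V" "v0 \<in> V" "v0 \<noteq> 0"
    and W: "finite W" and Y: "finite Y" "N * card W \<le> card Y"
    and r: "0 < r" "\<And>y. y \<in> Y \<Longrightarrow> \<bar>y\<bar> \<le> r"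
    and Q: "\<And>a \<omega>. a < N \<Longrightarrow> \<omega> \<in> W \<Longrightarrow> (2 * r) ^ a * exp (\<bar>\<omega>\<bar> * (2 * r)) \<le> real Q"
    and D: "1 \<le> D" "D \<le> Q"
    and acts: "\<And>a \<omega> y. a < N \<Longrightarrow> \<omega> \<in> W \<Longrightarrow> y \<in> Y \<Longrightarrow>
      acts_on_span V (real D * (y ^ a * exp (\<omega> * y))) (int Q)"
    and T: "0 < T" "(2 * card V + 4) * T \<le> N * card W"
    and large: "2 * (4 * (N * card W)\<^sup>2 * Q\<^sup>2) ^ (2 * card V + 2) < (2::nat) ^ T"
  shows False
proof -
  define m where "m = card V"
  define L where "L = N * card W"
  define G where "G = 4 * L\<^sup>2 * Q\<^sup>2"
  define \<Lambda> where "\<Lambda> = {..<N} \<times> W"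
  have large: "2 * G ^ (2 * m + 2) < 2 ^ T" using large by (simp add: G_def L_def m_def)
  have Q1: "1 \<le> Q" using D by simp
  have TL: "T \<le> L" "1 \<le> L"
  proof -
    have "1 * T \<le> (2 * card V + 4) * T" by (intro mult_le_mono1) simp
    then show "T \<le> L" unfolding L_def using T(2) by linarith
    then show "1 \<le> L" using T by simp
  qed
  have LQ: "1 \<le> L * Q" using Q1 TL by simp
  have G: "4 \<le> G" "L * Q \<le> G" "L * Q\<^sup>2 \<le> G"
  proof -
    have "G = 4 * ((L * Q) * (L * Q))" by (simp add: G_def power2_eq_square)
    moreover have "L * Q \<le> (L * Q) * (L * Q)" by (rule le_square)
    ultimately show "4 \<le> G" "L * Q \<le> G" using LQ by linarith+
    have "L * Q\<^sup>2 \<le> L\<^sup>2 * Q\<^sup>2"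
      using TL by (intro mult_le_mono1) (simp add: power2_eq_square)
    then show "L * Q\<^sup>2 \<le> G" unfolding G_def by linarith
  qed
  have card: "card \<Lambda> = L" by (simp add: \<Lambda>_def L_def card_cartesian_product)
  have fin: "finite \<Lambda>" using W by (simp add: \<Lambda>_def)
  define c where "c l k = monom_exp_coeff (fst l) (snd l) k * r ^ k" for l k
  have c: "\<bar>c l k\<bar> \<le> real Q" if "l \<in> \<Lambda>" for l k
  proof -
    have "\<bar>c l k\<bar> \<le> r ^ fst l * exp (\<bar>snd l\<bar> * r)"
      unfolding c_def using r by (intro monom_exp_coeff_le) auto
    also have "\<dots> \<le> (2 * r) ^ fst l * exp (\<bar>snd l\<bar> * (2 * r))"
      using r(1) by (intro mult_mono power_mono) (auto intro!: mult_left_mono)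
    also have "\<dots> \<le> real Q" using that by (intro Q) (auto simp: \<Lambda>_def)
    finally show ?thesis .
  qed
  have ex1: "(2 * m + 3 + 1) * T \<le> card \<Lambda>" using T(2) unfolding card L_def m_def by (simp add: add.commute)
  have ex2: "2 \<le> G" using G by simp
  have ex3: "0 < real Q" using Q1 by simp
  obtain x :: "nat \<times> real \<Rightarrow> int" where x: "\<exists>l\<in>\<Lambda>. x l \<noteq> 0"
    "\<And>l. l \<in> \<Lambda> \<Longrightarrow> \<bar>x l\<bar> \<le> int G"
    "\<And>k. k < T \<Longrightarrow> \<bar>\<Sum>l\<in>\<Lambda>. of_int (x l) * c l k\<bar> * real G ^ (2 * m + 3) \<le> 2 * real (card \<Lambda>) * real G * real Q"
    by (rule small_linear_forms[where c = c, OF fin ex1 T(1) ex2 c ex3]) (assumption, rule that)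
  define f where "f l y = y ^ fst l * exp (snd l * y)" for l :: "nat \<times> real" and y
  define F where "F y = (\<Sum>l\<in>\<Lambda>. of_int (x l) * f l y)" for y
  obtain y where y: "y \<in> Y" "F y \<noteq> 0"
  proof (rule exp_poly_combination_nonzero[OF W x(1)[unfolded \<Lambda>_def] Y])
    fix y assume "y \<in> Y"
      "(\<Sum>(a, \<omega>)\<in>{..<N} \<times> W. of_int (x (a, \<omega>)) * (y ^ a * exp (\<omega> * y))) \<noteq> 0"
    then show thesis
      by (intro that[of y]) (simp_all add: F_def f_def \<Lambda>_def case_prod_beta')
  qed
  have "acts_on_span V (of_int (x l) * (real D * f l y)) (\<bar>x l\<bar> * int Q)" if "l \<in> \<Lambda>" for l
    using that y(1) by (intro acts_on_span_mult acts_on_span_of_int V) (auto simp: f_def \<Lambda>_def intro!: acts)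
  then have "acts_on_span V (\<Sum>l\<in>\<Lambda>. of_int (x l) * (real D * f l y)) (\<Sum>l\<in>\<Lambda>. \<bar>x l\<bar> * int Q)"
    by (intro acts_on_span_sum V)
  moreover have "(\<Sum>l\<in>\<Lambda>. of_int (x l) * (real D * f l y)) = real D * F y"
    by (simp add: F_def sum_distrib_left mult.left_commute)
  moreover have "(\<Sum>l\<in>\<Lambda>. \<bar>x l\<bar> * int Q) \<le> int (G * G)"
  proof -
    have "(\<Sum>l\<in>\<Lambda>. \<bar>x l\<bar> * int Q) \<le> (\<Sum>l\<in>\<Lambda>. int G * int Q)"
      using x(2) by (intro sum_mono mult_right_mono) auto
    also have "\<dots> = int (L * Q * G)" by (simp add: card)
    also have "\<dots> \<le> int (G * G)" using G(2) by (simp only: of_nat_le_iff mult_le_mono1)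
    finally show ?thesis .
  qed
  ultimately have "acts_on_span V (real D * F y) (int (G * G))"
    by (simp only: acts_on_span_mono)
  then have "1 \<le> \<bar>real D * F y\<bar> * of_int (int (G * G)) ^ card V"
  proof (rule liouville_bound[OF V])
    show "real D * F y \<noteq> 0" using D(1) y(2) by simp
    have "1 * 1 \<le> G * G" using G(1) by (intro mult_le_mono) auto
    then show "1 \<le> int (G * G)" by linarith
  qed
  then have "1 \<le> real D * \<bar>F y\<bar> * real G ^ (2 * m)"
    by (simp add: abs_mult m_def power_mult power2_eq_square)
  also have "\<dots> \<le> real Q * \<bar>F y\<bar> * real G ^ (2 * m)"
    using D by (intro mult_right_mono) auto
  finally have lower: "1 \<le> real Q * \<bar>F y\<bar> * real G ^ (2 * m)" .
  define t where "t l = (\<Sum>k<T. monom_exp_coeff (fst l) (snd l) k * y ^ k)" for l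
  have yr: "\<bar>y\<bar> \<le> r" using r y by blast
  have "F y = (\<Sum>l\<in>\<Lambda>. of_int (x l) * (f l y - t l)) + (\<Sum>l\<in>\<Lambda>. of_int (x l) * t l)"
    by (simp add: F_def sum.distrib[symmetric] algebra_simps)
  also have "(\<Sum>l\<in>\<Lambda>. of_int (x l) * t l) = (\<Sum>k<T. (\<Sum>l\<in>\<Lambda>. of_int (x l) * c l k) * (y / r) ^ k)"
    unfolding t_def sum_distrib_left sum_distrib_right
    by (subst sum.swap) (use r(1) in \<open>simp add: c_def power_divide\<close>)
  finally have Fy: "F y = (\<Sum>l\<in>\<Lambda>. of_int (x l) * (f l y - t l)) +
      (\<Sum>k<T. (\<Sum>l\<in>\<Lambda>. of_int (x l) * c l k) * (y / r) ^ k)" .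
  \<comment> \<open>The two parts of \<open>F y\<close> are bounded separately: \<open>rem\<close> has the gain \<open>2 ^ T\<close> of the
    Taylor remainder, \<open>main\<close> the gain from the pigeonhole principle.\<close>
  have rem: "\<bar>\<Sum>l\<in>\<Lambda>. of_int (x l) * (f l y - t l)\<bar> * 2 ^ T \<le> real L * real G * real Q"
  proof -
    have "\<bar>\<Sum>l\<in>\<Lambda>. of_int (x l) * (f l y - t l)\<bar> * 2 ^ T \<le> (\<Sum>l\<in>\<Lambda>. \<bar>of_int (x l) * (f l y - t l)\<bar>) * 2 ^ T"
      by (intro mult_right_mono sum_abs) auto
    also have "\<dots> = (\<Sum>l\<in>\<Lambda>. \<bar>of_int (x l)\<bar> * (\<bar>f l y - t l\<bar> * 2 ^ T))"
      by (simp add: sum_distrib_right abs_mult mult.assoc)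
    also have "\<dots> \<le> (\<Sum>l\<in>\<Lambda>. real G * real Q)"
    proof (intro sum_mono mult_mono)
      fix l assume l: "l \<in> \<Lambda>"
      show "\<bar>real_of_int (x l)\<bar> \<le> real G" using x(2)[OF l] by linarith
      have "\<bar>f l y - t l\<bar> * 2 ^ T \<le> (2 * r) ^ fst l * exp (\<bar>snd l\<bar> * (2 * r))"
        unfolding f_def t_def by (rule monom_exp_taylor_remainder[OF yr])
      also have "\<dots> \<le> real Q" using l by (intro Q) (auto simp: \<Lambda>_def)
      finally show "\<bar>f l y - t l\<bar> * 2 ^ T \<le> real Q" .
    qed auto
    also have "\<dots> = real L * real G * real Q" by (simp add: card)
    finally show ?thesis .
  qed
  have main: "\<bar>\<Sum>k<T. (\<Sum>l\<in>\<Lambda>. of_int (x l) * c l k) * (y / r) ^ k\<bar> * real G ^ (2 * m + 3)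
      \<le> real T * (2 * real L * real G * real Q)"
  proof -
    have "\<bar>\<Sum>k<T. (\<Sum>l\<in>\<Lambda>. of_int (x l) * c l k) * (y / r) ^ k\<bar> * real G ^ (2 * m + 3)
       \<le> (\<Sum>k<T. \<bar>(\<Sum>l\<in>\<Lambda>. of_int (x l) * c l k) * (y / r) ^ k\<bar>) * real G ^ (2 * m + 3)"
      by (intro mult_right_mono sum_abs) auto
    also have "\<dots> \<le> (\<Sum>k<T. \<bar>\<Sum>l\<in>\<Lambda>. of_int (x l) * c l k\<bar>) * real G ^ (2 * m + 3)"
    proof (intro mult_right_mono sum_mono)
      fix k
      have "\<bar>y / r\<bar> ^ k \<le> 1" using yr r(1) by (intro power_le_one) auto
      then show "\<bar>(\<Sum>l\<in>\<Lambda>. of_int (x l) * c l k) * (y / r) ^ k\<bar> \<le> \<bar>\<Sum>l\<in>\<Lambda>. of_int (x l) * c l k\<bar>"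
        by (simp add: abs_mult power_abs mult_left_le)
    qed auto
    also have "\<dots> \<le> (\<Sum>k<T. 2 * real (card \<Lambda>) * real G * real Q)"
      unfolding sum_distrib_right by (intro sum_mono x(3)) auto
    also have "\<dots> = real T * (2 * real L * real G * real Q)" by (simp add: card)
    finally show ?thesis .
  qed
  define A where "A = \<bar>\<Sum>l\<in>\<Lambda>. of_int (x l) * (f l y - t l)\<bar>"
  define B where "B = \<bar>\<Sum>k<T. (\<Sum>l\<in>\<Lambda>. of_int (x l) * c l k) * (y / r) ^ k\<bar>"
  have G0: "0 < real G" using G by simp
  have "2 * (real Q * A * real G ^ (2 * m)) < 1"
  proof -
    have "real Q * A * real G ^ (2 * m) * 2 ^ T = real Q * real G ^ (2 * m) * (A * 2 ^ T)" by simp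
    also have "\<dots> \<le> real Q * real G ^ (2 * m) * (real L * real G * real Q)"
      using rem by (intro mult_left_mono) (auto simp: A_def)
    also have "\<dots> = real (L * Q\<^sup>2) * (real G * real G ^ (2 * m))"
      by (simp add: power2_eq_square)
    also have "\<dots> \<le> real G * (real G * real G ^ (2 * m))"
      using G(3) by (intro mult_right_mono) (simp_all only: of_nat_le_iff, auto)
    also have "\<dots> = real (G ^ (2 * m + 2))" by simp
    finally have "2 * (real Q * A * real G ^ (2 * m)) * 2 ^ T \<le> real (2 * G ^ (2 * m + 2))" by simp
    also have "\<dots> < real (2 ^ T)" using large by (simp only: of_nat_less_iff)
    finally show ?thesis by simp
  qed
  moreover have "2 * (real Q * B * real G ^ (2 * m)) \<le> 1"
  proof -
    have "2 * (real Q * B * real G ^ (2 * m)) * real G ^ 3 = 2 * real Q * (B * real G ^ (2 * m + 3))"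
      by (simp add: power_add)
    also have "\<dots> \<le> 2 * real Q * (real T * (2 * real L * real G * real Q))"
      using main by (intro mult_left_mono) (auto simp: B_def)
    also have "\<dots> \<le> 2 * real Q * (real L * (2 * real L * real G * real Q))"
      using TL by (intro mult_left_mono mult_right_mono) auto
    also have "\<dots> = real G * real G"
      by (simp add: G_def power2_eq_square)
    also have "\<dots> \<le> real G ^ 3"
      using G(1) by (simp add: power3_eq_cube)
    finally show ?thesis using G0 by simp
  qed
  moreover have "real Q * \<bar>F y\<bar> * real G ^ (2 * m) \<le> real Q * (A + B) * real G ^ (2 * m)"
    unfolding Fy A_def B_def by (intro mult_right_mono mult_left_mono abs_triangle_ineq) auto
  moreover have "real Q * (A + B) * real G ^ (2 * m) =
      real Q * A * real G ^ (2 * m) + real Q * B * real G ^ (2 * m)"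
    by (simp only: distrib_left distrib_right)
  ultimately show False using lower by linarith
qed

section \<open>Sizes of values and choice of parameters\<close>

text \<open>
  The numerical hypothesis of the preceding theorem only asks that the logarithm of the size bound \<open>Q\<close>
  be of smaller order than the number \<open>L\<close> of functions.
\<close>

lemma eventually_parameters:
  fixes L Q :: "nat \<Rightarrow> nat" and m :: nat
  assumes L: "filterlim L at_top sequentially" and Q: "\<And>n. 0 < n \<Longrightarrow> 1 \<le> Q n"
    and QL: "(\<lambda>n. ln (real (Q n)) / real (L n)) \<longlonglongrightarrow> 0"
  shows "\<forall>\<^sub>F n in sequentially. 0 < L n div (2 * m + 4) \<and>
    2 * (4 * (L n)\<^sup>2 * (Q n)\<^sup>2) ^ (2 * m + 2) < (2::nat) ^ (L n div (2 * m + 4))"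
proof -
  have Lr: "filterlim (\<lambda>n. real (L n)) at_top sequentially"
    using L filterlim_real_sequentially by (rule filterlim_compose[rotated])
  have lnL: "(\<lambda>n. ln (real (L n)) / real (L n)) \<longlonglongrightarrow> 0"
    using ln_x_over_x_tendsto_0 Lr by (rule filterlim_compose)
  have invL: "(\<lambda>n. 1 / real (L n)) \<longlonglongrightarrow> 0"
    using tendsto_inverse_0_at_top[OF Lr] by (simp add: inverse_eq_divide)
  have "(\<lambda>n. ln 2 * (1 / real (L n)) + real (2 * m + 2) * (ln 4 * (1 / real (L n))
      + 2 * (ln (real (L n)) / real (L n)) + 2 * (ln (real (Q n)) / real (L n)))
      - ln 2 * (1 / real (2 * m + 4) - 1 / real (L n)))
    \<longlonglongrightarrow> ln 2 * 0 + real (2 * m + 2) * (ln 4 * 0 + 2 * 0 + 2 * 0) - ln 2 * (1 / real (2 * m + 4) - 0)"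
    by (intro tendsto_intros invL lnL QL)
  then have "\<forall>\<^sub>F n in sequentially. ln 2 * (1 / real (L n)) + real (2 * m + 2) * (ln 4 * (1 / real (L n))
      + 2 * (ln (real (L n)) / real (L n)) + 2 * (ln (real (Q n)) / real (L n)))
      - ln 2 * (1 / real (2 * m + 4) - 1 / real (L n)) < 0"
    by (rule order_tendstoD) simp
  moreover have "\<forall>\<^sub>F n in sequentially. 2 * m + 4 \<le> L n"
    using L by (simp add: filterlim_at_top)
  moreover have "\<forall>\<^sub>F n in sequentially. 0 < n" by (rule eventually_gt_at_top)
  ultimately show ?thesis
  proof eventually_elim
    case (elim n)
    define T where "T = L n div (2 * m + 4)"
    define E where "E = 4 * (L n)\<^sup>2 * (Q n)\<^sup>2"
    have pos: "0 < real (L n)" "0 < real (Q n)" using elim(2) Q[OF elim(3)] by simp_all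
    have T: "0 < T" using elim(2) by (simp add: T_def div_greater_zero_iff)
    have lnE: "ln (real E) = ln 4 + 2 * ln (real (L n)) + 2 * ln (real (Q n))"
      using pos by (simp add: E_def ln_mult ln_realpow)
    have "L n < (2 * m + 4) + (2 * m + 4) * T"
      unfolding T_def by (rule dividend_less_times_div) simp
    then have "real (L n) < real ((2 * m + 4) + (2 * m + 4) * T)" by (simp only: of_nat_less_iff)
    then have "real (L n) / real (2 * m + 4) - 1 \<le> real T" by (simp add: field_simps)
    then have T': "ln 2 * (real (L n) / real (2 * m + 4) - 1) \<le> ln 2 * real T"
      by (intro mult_left_mono) auto
    have "real (L n) * (ln 2 * (1 / real (L n)) + real (2 * m + 2) * (ln 4 * (1 / real (L n))
      + 2 * (ln (real (L n)) / real (L n)) + 2 * (ln (real (Q n)) / real (L n)))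
      - ln 2 * (1 / real (2 * m + 4) - 1 / real (L n))) < 0"
      using elim(1) pos(1) by (simp only: mult_pos_neg)
    also have "real (L n) * (ln 2 * (1 / real (L n)) + real (2 * m + 2) * (ln 4 * (1 / real (L n))
      + 2 * (ln (real (L n)) / real (L n)) + 2 * (ln (real (Q n)) / real (L n)))
      - ln 2 * (1 / real (2 * m + 4) - 1 / real (L n)))
      = ln 2 + real (2 * m + 2) * ln (real E) - ln 2 * (real (L n) / real (2 * m + 4) - 1)"
    proof -
      \<comment> \<open>The computation is done for free variables, since the simplifier would rewrite the actual terms.\<close>
      have X: "b * (p * (1 / b) + k * (q * (1 / b) + 2 * (l / b) + 2 * (z / b)) - p * (1 / w - 1 / b))
        = p + k * (q + 2 * l + 2 * z) - p * (b / w - 1)" if "b > 0" for b p k q l z w :: real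
      proof -
        have "b * (p * (1 / b) + k * (q * (1 / b) + 2 * (l / b) + 2 * (z / b)) - p * (1 / w - 1 / b))
          = p * (b / b) + k * (q * (b / b) + 2 * (l * (b / b)) + 2 * (z * (b / b))) - p * (b / w - b / b)"
          by (simp add: algebra_simps)
        then show ?thesis using that by simp
      qed
      show ?thesis unfolding lnE by (rule X[OF pos(1)])
    qed
    finally have "ln 2 + real (2 * m + 2) * ln (real E) < ln 2 * real T"
      using T' by linarith
    moreover have E0: "0 < real E" using pos by (simp add: E_def)
    then have "ln (2 * real E ^ (2 * m + 2)) = ln 2 + real (2 * m + 2) * ln (real E)"
      by (simp add: ln_mult ln_realpow del: power_Suc)
    ultimately have "ln (2 * real E ^ (2 * m + 2)) < ln (2 ^ T)"
      by (simp add: ln_realpow mult.commute)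
    moreover have "0 < 2 * real E ^ (2 * m + 2)" using E0 by simp
    ultimately have "2 * real E ^ (2 * m + 2) < 2 ^ T" by (simp only: ln_less_cancel_iff zero_less_power zero_less_numeral)
    then have "real (2 * E ^ (2 * m + 2)) < real (2 ^ T)" by simp
    then have "2 * E ^ (2 * m + 2) < 2 ^ T" by (simp only: of_nat_less_iff)
    then show ?case using T by (simp add: T_def E_def)
  qed
qed

text \<open>
  The exponent \<open>k\<close> is a logarithmic height. It bounds the power of the denominator and the matrix entries
  at the same time, so that it simply adds up under multiplication.
\<close>

definition has_size :: "real set \<Rightarrow> nat \<Rightarrow> nat \<Rightarrow> nat \<Rightarrow> real \<Rightarrow> bool"
  where "has_size V c H k x \<longleftrightarrow> acts_on_span V (real c ^ k * x) (int (H ^ k))"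

lemma has_size_mult:
  assumes "has_size V c H j x" "has_size V c H k y"
  shows "has_size V c H (j + k) (x * y)"
  using acts_on_span_mult[OF assms[unfolded has_size_def]]
  by (simp add: has_size_def power_add mult_ac)

lemma has_size_one: "finite V \<Longrightarrow> has_size V c H 0 1"
  using acts_on_span_of_int[of V 1] by (simp add: has_size_def)

lemma has_size_power:
  assumes "finite V" "has_size V c H k x"
  shows "has_size V c H (n * k) (x ^ n)"
  by (induction n) (use assms has_size_mult has_size_one in auto)

lemma has_size_prod:
  assumes "finite V" "\<And>i. i \<in> I \<Longrightarrow> has_size V c H (k i) (x i)"
  shows "has_size V c H (\<Sum>i\<in>I. k i) (\<Prod>i\<in>I. x i)"
  using assms(2)
  by (induction I rule: infinite_finite_induct) (auto intro: has_size_mult has_size_one[OF assms(1)])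

lemma has_size_mono:
  assumes "finite V" "c \<le> H" "has_size V c H j x" "j \<le> k"
  shows "has_size V c H k x"
proof -
  have "acts_on_span V (of_int (int (c ^ (k - j)))) (int (H ^ (k - j)))"
    by (rule acts_on_span_mono[OF acts_on_span_of_int[OF assms(1)]])
       (use assms(2) in \<open>simp add: power_mono\<close>)
  then have "has_size V c H (k - j) 1" by (simp add: has_size_def)
  from has_size_mult[OF assms(3) this] show ?thesis using assms(4) by simp
qed

lemma lattice_algebraic_has_size:
  assumes "finite X" "\<And>x. x \<in> X \<Longrightarrow> lattice_algebraic {x}"
  obtains V v0 c H where "finite V" "v0 \<in> V" "v0 \<noteq> 0" "0 < c" "c \<le> H"
    "\<And>x. x \<in> X \<Longrightarrow> has_size V c H 1 x"
proof -
  obtain V c where V: "finite V" "\<exists>v\<in>V. v \<noteq> 0" "0 < c" "\<forall>x\<in>X. integral_over V c x"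
    using lattice_algebraic_finite[OF assms] unfolding lattice_algebraic_def by blast
  have "\<forall>x\<in>X. \<exists>h. acts_on_span V (real c * x) h"
    using V(4) acts_on_span_iff_stable[OF V(1)] by (simp add: integral_over_def)
  then obtain h where h: "\<forall>x\<in>X. acts_on_span V (real c * x) (h x)"
    by (auto simp: bchoice_iff)
  define H where "H = c + nat (\<Sum>x\<in>X. \<bar>h x\<bar>)"
  have "has_size V c H 1 x" if "x \<in> X" for x
  proof -
    have "\<bar>h x\<bar> \<le> (\<Sum>x\<in>X. \<bar>h x\<bar>)"
      using that assms(1) by (intro member_le_sum) auto
    then have "h x \<le> int H" by (simp add: H_def)
    then show ?thesis using h that acts_on_span_mono by (auto simp: has_size_def)
  qed
  moreover obtain v0 where "v0 \<in> V" "v0 \<noteq> 0" using V(2) by blast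
  ultimately show thesis using that[of V v0 c H] V by (simp add: H_def)
qed

section \<open>The six exponentials theorem for powers of a transcendental number\<close>

definition coord_point :: "real \<Rightarrow> (nat \<Rightarrow> nat) \<Rightarrow> real"
  where "coord_point s u = (\<Sum>i<3. real (u i) * s ^ i)"

lemma coord_point_inj:
  assumes "\<not> algebraic s"
  shows "inj_on (coord_point s) (PiE {..<3} (\<lambda>_. {..<n}))"
proof (rule inj_onI)
  fix u v assume uv: "u \<in> PiE {..<3} (\<lambda>_. {..<n})" "v \<in> PiE {..<3} (\<lambda>_. {..<n})"
    and eq: "coord_point s u = coord_point s v"
  define p where "p = (\<Sum>i<3. monom (real_of_int (int (u i) - int (v i))) i)"
  have coeff: "coeff p i = (if i < 3 then real_of_int (int (u i) - int (v i)) else 0)" for i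
    by (simp add: p_def coeff_sum if_distrib cong: if_cong)
  have "poly p s = coord_point s u - coord_point s v"
    by (simp add: p_def coord_point_def poly_sum poly_monom left_diff_distrib sum_subtractf)
  then have "poly p s = 0" using eq by simp
  moreover have "coeff p i \<in> \<int>" for i by (simp add: coeff)
  ultimately have "p = 0" using assms algebraicI by blast
  then have "u i = v i" if "i < 3" for i using coeff[of i] that by simp
  then show "u = v" using uv by (intro PiE_ext[of u]) auto
qed

lemma coord_point_bound:
  assumes "u \<in> PiE {..<3} (\<lambda>_. {..<n})"
  shows "\<bar>coord_point s u\<bar> \<le> real n * (\<Sum>i<3. \<bar>s\<bar> ^ i)"
proof -
  have "\<bar>coord_point s u\<bar> \<le> (\<Sum>i<3. \<bar>real (u i) * s ^ i\<bar>)"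
    unfolding coord_point_def by (rule sum_abs)
  also have "\<dots> \<le> (\<Sum>i<3. real n * \<bar>s\<bar> ^ i)"
  proof (rule sum_mono)
    fix i assume "i \<in> {..<3::nat}"
    then have "u i < n" using assms by auto
    then show "\<bar>real (u i) * s ^ i\<bar> \<le> real n * \<bar>s\<bar> ^ i"
      by (auto simp: abs_mult power_abs intro!: mult_right_mono)
  qed
  finally show ?thesis by (simp add: sum_distrib_left)
qed

lemma exp_coord_points:
  "exp (l * coord_point s a * coord_point s u) = (\<Prod>(i, j)\<in>{..<3} \<times> {..<3}. exp (l * s ^ (i + j)) ^ (a i * u j))"
proof -
  have "l * coord_point s a * coord_point s u =
      (\<Sum>i<3. \<Sum>j<3. (l * (real (a i) * s ^ i)) * (real (u j) * s ^ j))"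
    unfolding coord_point_def sum_distrib_left[of l] sum_product ..
  also have "\<dots> = (\<Sum>(i, j)\<in>{..<3} \<times> {..<3}. real (a i * u j) * (l * s ^ (i + j)))"
    unfolding sum.cartesian_product by (intro sum.cong) (auto simp: power_add)
  finally show ?thesis
    by (simp only: exp_sum finite_lessThan finite_cartesian_product case_prod_beta' exp_of_nat_mult)
qed

lemma exp_coord_points_has_size:
  assumes V: "finite V" and c: "c \<le> H" and size: "\<And>k. k < 5 \<Longrightarrow> has_size V c H 1 (exp (l * s ^ k))"
    and uv: "u \<in> PiE {..<3} (\<lambda>_. {..<n})" "v \<in> PiE {..<3} (\<lambda>_. {..<n})"
  shows "has_size V c H (9 * n\<^sup>2) (exp (l * coord_point s u * coord_point s v))"
proof -
  have size': "has_size V c H (u (fst p) * v (snd p)) (exp (l * s ^ (fst p + snd p)) ^ (u (fst p) * v (snd p)))"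
    if p: "p \<in> {..<3} \<times> {..<3}" for p
  proof -
    have "fst p + snd p < 5" using p by auto
    from has_size_power[OF V size[OF this], of "u (fst p) * v (snd p)"] show ?thesis
      by (simp only: mult_1_right)
  qed
  have "u (fst p) * v (snd p) \<le> n * n" if "p \<in> {..<3} \<times> {..<3}" for p
  proof -
    have "fst p \<in> {..<3}" "snd p \<in> {..<3}" using that by (auto simp del: lessThan_iff)
    then have "u (fst p) < n" "v (snd p) < n" using PiE_mem[OF uv(1)] PiE_mem[OF uv(2)] by blast+
    then show ?thesis by (intro mult_le_mono) simp_all
  qed
  then have "(\<Sum>p\<in>{..<3} \<times> {..<3}. u (fst p) * v (snd p)) \<le> (\<Sum>p\<in>{..<3::nat} \<times> {..<3::nat}. n * n)"
    by (rule sum_mono)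
  then have le: "(\<Sum>p\<in>{..<3} \<times> {..<3}. u (fst p) * v (snd p)) \<le> 9 * n\<^sup>2"
    by (simp add: power2_eq_square)
  have "has_size V c H (\<Sum>p\<in>{..<3} \<times> {..<3}. u (fst p) * v (snd p)) (exp (l * coord_point s u * coord_point s v))"
    unfolding exp_coord_points case_prod_beta' by (rule has_size_prod[OF V size'])
  from has_size_mono[OF V c this le] show ?thesis .
qed

text \<open>
  A case of the six exponentials theorem. For transcendental \<open>s\<close> both the points \<open>u\<^sub>0 + u\<^sub>1 s + u\<^sub>2 s\<^sup>2\<close> and
  the frequencies, which are \<open>l\<close> times such points, are pairwise distinct. With coordinates below \<open>n\<close> there are
  \<open>n ^ 3\<close> functions, whereas the values at the points are monomials of degree \<open>O(n\<^sup>2)\<close> in the five given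
  algebraic numbers; the exponent 3 beats the exponent 2.
\<close>

theorem transcendental_multiplier_contradiction:
  fixes l s :: real
  assumes l: "l \<noteq> 0" and s: "\<not> algebraic s"
    and alg: "\<And>k. k < 5 \<Longrightarrow> lattice_algebraic {exp (l * s ^ k)}"
  shows False
proof -
  define X where "X = (\<lambda>k. exp (l * s ^ k)) ` {..<5::nat}"
  have "finite X" "\<And>x. x \<in> X \<Longrightarrow> lattice_algebraic {x}" using alg by (auto simp: X_def)
  then obtain V v0 c H where V: "finite V" "v0 \<in> V" "v0 \<noteq> 0" and c: "0 < c" "c \<le> H"
    and "\<And>x. x \<in> X \<Longrightarrow> has_size V c H 1 x"
    by (rule lattice_algebraic_has_size) (assumption, rule that)
  then have size1: "has_size V c H 1 (exp (l * s ^ k))" if "k < 5" for k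
    using that unfolding X_def by blast
  define C where "C = (\<Sum>i<3. \<bar>s\<bar> ^ i)"
  have C: "0 < C" by (simp add: C_def eval_nat_numeral add_pos_nonneg)
  \<comment> \<open>\<open>M\<close> dominates both the arithmetic size and the growth of the exponentials on the interval of radius \<open>2 r\<close>.\<close>
  define M where "M = H + nat \<lceil>exp (2 * \<bar>l\<bar> * C\<^sup>2)\<rceil>"
  have M: "H \<le> M" "1 \<le> M" using c by (auto simp: M_def)
  have expM: "exp (2 * \<bar>l\<bar> * C\<^sup>2) \<le> real M"
    unfolding M_def of_nat_add using real_nat_ceiling_ge[of "exp (2 * \<bar>l\<bar> * C\<^sup>2)"] by linarith
  define Q where "Q n = M ^ (9 * n\<^sup>2)" for n
  have "(\<lambda>n. 9 * ln (real M) * (1 / real n)) \<longlonglongrightarrow> 9 * ln (real M) * 0"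
    by (intro tendsto_intros lim_1_over_n)
  then have "(\<lambda>n. 9 * ln (real M) * (1 / real n)) \<longlonglongrightarrow> 0" by simp
  then have "(\<lambda>n. ln (real (Q n)) / real (n ^ 3)) \<longlonglongrightarrow> 0"
    by (rule Lim_transform_eventually[rotated 0], intro always_eventually allI)
      (use M in \<open>auto simp: Q_def ln_realpow field_simps power2_eq_square power3_eq_cube\<close>)
  moreover have "filterlim (\<lambda>n. n ^ 3) at_top (sequentially :: nat filter)"
    by (rule filterlim_at_top_mono[OF filterlim_ident]) (auto intro!: always_eventually simp: power3_eq_cube)
  ultimately have "\<forall>\<^sub>F n in sequentially. 0 < n ^ 3 div (2 * card V + 4) \<and>
    2 * (4 * (n ^ 3)\<^sup>2 * (Q n)\<^sup>2) ^ (2 * card V + 2) < (2::nat) ^ (n ^ 3 div (2 * card V + 4))"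
    using M by (intro eventually_parameters) (auto simp: Q_def)
  from eventually_happens[OF this] obtain n where n: "0 < n ^ 3 div (2 * card V + 4)"
    "2 * (4 * (n ^ 3)\<^sup>2 * (Q n)\<^sup>2) ^ (2 * card V + 2) < (2::nat) ^ (n ^ 3 div (2 * card V + 4))"
    by auto
  define T where "T = n ^ 3 div (2 * card V + 4)"
  have T: "0 < T" "(2 * card V + 4) * T \<le> n ^ 3"
    unfolding T_def by (rule n, rule times_div_less_eq_dividend)
  have large: "2 * (4 * (n ^ 3)\<^sup>2 * (Q n)\<^sup>2) ^ (2 * card V + 2) < (2::nat) ^ T"
    unfolding T_def by (rule n)
  have n0: "0 < n" using T by (cases n) auto
  define U where "U = PiE {..<3::nat} (\<lambda>_. {..<n})"
  define Y where "Y = coord_point s ` U"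
  define W where "W = (\<lambda>u. l * coord_point s u) ` U"
  have U: "finite U" "card U = n ^ 3" by (auto simp: U_def card_PiE intro!: finite_PiE)
  have inj: "inj_on (coord_point s) U" unfolding U_def by (rule coord_point_inj[OF s])
  then have cardY: "card Y = n ^ 3" by (simp add: Y_def card_image U)
  have "inj_on (\<lambda>u. l * coord_point s u) U" using inj l by (auto simp: inj_on_def)
  then have cardW: "card W = n ^ 3" by (simp add: W_def card_image U)
  have bound: "\<bar>coord_point s u\<bar> \<le> real n * C" if "u \<in> U" for u
    using coord_point_bound that by (simp add: U_def C_def)
  show False
  proof (rule exponential_values_contradiction[OF V, where W = W and Y = Y and N = 1 and r = "real n * C"
        and Q = "Q n" and D = "c ^ (9 * n\<^sup>2)" and T = T])
    show "finite W" "finite Y" by (simp_all add: W_def Y_def U)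
    show "1 * card W \<le> card Y" by (simp add: cardY cardW)
    show "0 < real n * C" using n0 C by simp
    show "\<bar>y\<bar> \<le> real n * C" if "y \<in> Y" for y using that bound by (auto simp: Y_def)
    show "(2 * (real n * C)) ^ a * exp (\<bar>\<omega>\<bar> * (2 * (real n * C))) \<le> real (Q n)"
      if aw: "a < 1" "\<omega> \<in> W" for a \<omega>
    proof -
      obtain u where u: "u \<in> U" "\<omega> = l * coord_point s u" using aw by (auto simp: W_def)
      have "\<bar>\<omega>\<bar> * (2 * (real n * C)) \<le> (\<bar>l\<bar> * (real n * C)) * (2 * (real n * C))"
        unfolding u(2) abs_mult using bound[OF u(1)] C by (intro mult_right_mono mult_left_mono) auto
      also have "\<dots> = real (n\<^sup>2) * (2 * \<bar>l\<bar> * C\<^sup>2)" by (simp add: power2_eq_square)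
      finally have "exp (\<bar>\<omega>\<bar> * (2 * (real n * C))) \<le> exp (2 * \<bar>l\<bar> * C\<^sup>2) ^ (n\<^sup>2)"
        by (subst exp_of_nat_mult[symmetric]) simp
      also have "\<dots> \<le> real M ^ (n\<^sup>2)" using expM by (intro power_mono) auto
      also have "\<dots> \<le> real M ^ (9 * n\<^sup>2)" using M by (intro power_increasing) auto
      finally show ?thesis using that by (simp add: Q_def)
    qed
    show "1 \<le> c ^ (9 * n\<^sup>2)" using c by simp
    show "c ^ (9 * n\<^sup>2) \<le> Q n" unfolding Q_def using c M by (intro power_mono) auto
    show "acts_on_span V (real (c ^ (9 * n\<^sup>2)) * (y ^ a * exp (\<omega> * y))) (int (Q n))"
      if awy: "a < 1" "\<omega> \<in> W" "y \<in> Y" for a \<omega> y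
    proof -
      obtain u where u: "u \<in> U" "\<omega> = l * coord_point s u" using awy by (auto simp: W_def)
      obtain v where v: "v \<in> U" "y = coord_point s v" using awy by (auto simp: Y_def)
      have "has_size V c H (9 * n\<^sup>2) (exp (\<omega> * y))"
        unfolding u(2) v(2) using u(1) v(1) size1
        by (intro exp_coord_points_has_size V c) (simp_all add: U_def)
      then have "acts_on_span V (real (c ^ (9 * n\<^sup>2)) * exp (\<omega> * y)) (int (H ^ (9 * n\<^sup>2)))"
        unfolding has_size_def of_nat_power .
      note a1 = this
      have "H ^ (9 * n\<^sup>2) \<le> Q n"
        unfolding Q_def by (rule power_mono[OF M(1)]) simp
      then have "int (H ^ (9 * n\<^sup>2)) \<le> int (Q n)" by (simp only: of_nat_le_iff)
      note a2 = this
      note sz = acts_on_span_mono[OF a1 a2]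
      have "a = 0" using awy(1) by simp
      then show ?thesis using sz by (simp only: power_0 mult_1)
    qed
    show "0 < T" by (rule T)
    show "(2 * card V + 4) * T \<le> 1 * card W" using T(2) by (simp only: cardW mult_1)
    show "2 * (4 * (1 * card W)\<^sup>2 * (Q n)\<^sup>2) ^ (2 * card V + 2) < 2 ^ T"
      using large by (simp only: cardW mult_1)
  qed
qed

section \<open>The real Gelfond-Schneider theorem\<close>

text \<open>
  The real case of the Gelfond-Schneider theorem, by Schneider's method. The functions are
  \<open>z ^ a * exp (b l z)\<close> with \<open>a < n ^ 3\<close> and \<open>b < n\<close>, the points \<open>u + v s\<close> with \<open>u, v < n\<^sup>2\<close>. There are \<open>n ^ 4\<close>
  functions and as many points, and the logarithm of the size of the values is \<open>O(n\<^sup>3 ln n)\<close>. The unequal ranges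
  for \<open>a\<close> and \<open>b\<close> balance the sizes of \<open>(u + v s) ^ a\<close> and of \<open>exp (b l (u + v s))\<close>.
\<close>

theorem irrational_algebraic_multiplier_contradiction:
  fixes l s :: real
  assumes l: "l \<noteq> 0" and s: "s \<notin> \<rat>"
    and alg: "lattice_algebraic {s}" "lattice_algebraic {exp l}" "lattice_algebraic {exp (l * s)}"
  shows False
proof -
  have "finite {s, exp l, exp (l * s)}" by simp
  moreover have "lattice_algebraic {x}" if "x \<in> {s, exp l, exp (l * s)}" for x
    using that alg by blast
  ultimately obtain V v0 c H where V: "finite V" "v0 \<in> V" "v0 \<noteq> 0" and c: "0 < c" "c \<le> H"
    and size: "\<And>x. x \<in> {s, exp l, exp (l * s)} \<Longrightarrow> has_size V c H 1 x"
    by (rule lattice_algebraic_has_size) (assumption, rule that)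
  define C where "C = 1 + \<bar>s\<bar>"
  have C: "1 \<le> C" by (simp add: C_def)
  \<comment> \<open>The factor \<open>H ^ 3\<close> collects one \<open>H\<close> from \<open>y ^ a\<close> and two from the exponential values.\<close>
  define M where "M = 2 * H ^ 3 + nat \<lceil>2 * C * exp (2 * \<bar>l\<bar> * C)\<rceil>"
  have "1 \<le> H ^ 3" using c by simp
  then have M: "2 * H ^ 3 \<le> M" "1 \<le> M" unfolding M_def by linarith+
  have CM: "2 * C * exp (2 * \<bar>l\<bar> * C) \<le> real M"
    unfolding M_def of_nat_add using real_nat_ceiling_ge[of "2 * C * exp (2 * \<bar>l\<bar> * C)"] by linarith
  define Q where "Q n = (M * n\<^sup>2) ^ (n ^ 3)" for n
  have "(\<lambda>n. ln (real M) * (1 / real n) + 2 * (ln (real n) / real n)) \<longlonglongrightarrow> ln (real M) * 0 + 2 * 0"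
    using ln_x_over_x_tendsto_0 filterlim_real_sequentially
    by (intro tendsto_intros lim_1_over_n) (rule filterlim_compose)
  then have "(\<lambda>n. ln (real M) * (1 / real n) + 2 * (ln (real n) / real n)) \<longlonglongrightarrow> 0" by simp
  moreover have "\<forall>\<^sub>F n in sequentially. ln (real M) * (1 / real n) + 2 * (ln (real n) / real n)
      = ln (real (Q n)) / real (n ^ 4)"
    using eventually_gt_at_top[of "0::nat"]
  proof eventually_elim
    case (elim n)
    have "ln (real (Q n)) = real (n ^ 3) * (ln (real M) + 2 * ln (real n))"
      using elim M by (simp add: Q_def ln_realpow ln_mult)
    then show ?case using elim by (simp add: field_simps eval_nat_numeral)
  qed
  ultimately have "(\<lambda>n. ln (real (Q n)) / real (n ^ 4)) \<longlonglongrightarrow> 0"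
    by (rule Lim_transform_eventually)
  moreover have "filterlim (\<lambda>n. n ^ 4) at_top (sequentially :: nat filter)"
  proof (rule filterlim_at_top_mono[OF filterlim_ident])
    have "n \<le> n ^ 4" for n :: nat by (cases "n = 0") (simp_all add: self_le_power)
    then show "\<forall>\<^sub>F n in sequentially. n \<le> n ^ 4" for n :: nat by simp
  qed
  moreover have "1 \<le> Q n" if "0 < n" for n using that M by (simp add: Q_def)
  ultimately have "\<forall>\<^sub>F n in sequentially. 0 < n ^ 4 div (2 * card V + 4) \<and>
    2 * (4 * (n ^ 4)\<^sup>2 * (Q n)\<^sup>2) ^ (2 * card V + 2) < (2::nat) ^ (n ^ 4 div (2 * card V + 4))"
    by (intro eventually_parameters)
  from eventually_happens[OF this] obtain n where n: "0 < n ^ 4 div (2 * card V + 4)"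
    "2 * (4 * (n ^ 4)\<^sup>2 * (Q n)\<^sup>2) ^ (2 * card V + 2) < (2::nat) ^ (n ^ 4 div (2 * card V + 4))"
    by auto
  define T where "T = n ^ 4 div (2 * card V + 4)"
  have T: "0 < T" "(2 * card V + 4) * T \<le> n ^ 4"
    unfolding T_def by (rule n, rule times_div_less_eq_dividend)
  have large: "2 * (4 * (n ^ 4)\<^sup>2 * (Q n)\<^sup>2) ^ (2 * card V + 2) < (2::nat) ^ T"
    unfolding T_def by (rule n)
  have n0: "0 < n" using T by (cases n) auto
  define pt where "pt = (\<lambda>(u, v). real u + real v * s)"
  define U where "U = {..<n\<^sup>2} \<times> {..<n\<^sup>2}"
  define Y where "Y = pt ` U"
  define W where "W = (\<lambda>b. real b * l) ` {..<n}"
  have inj: "inj_on pt U"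
  proof (rule inj_onI, clarify)
    fix u v u' v' assume "pt (u, v) = pt (u', v')"
    \<comment> \<open>Two representations of a point would make \<open>s\<close> rational.\<close>
    then have eq: "(real v - real v') * s = real u' - real u" by (simp add: pt_def algebra_simps)
    have "v = v'"
    proof (rule ccontr)
      assume "v \<noteq> v'"
      then have "s = (real u' - real u) / (real v - real v')" using eq by (simp add: field_simps)
      also have "\<dots> \<in> \<rat>" by simp
      finally show False using s by simp
    qed
    then show "u = u' \<and> v = v'" using eq by simp
  qed
  have cardY: "card Y = n ^ 4"
  proof -
    have "card U = n ^ 4" by (simp add: U_def card_cartesian_product power_add[symmetric])
    then show ?thesis by (simp only: Y_def card_image[OF inj])
  qed
  have Y_elem: "\<exists>u v. u < n\<^sup>2 \<and> v < n\<^sup>2 \<and> y = real u + real v * s" if "y \<in> Y" for y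
  proof -
    obtain p where p: "p \<in> U" "y = pt p" using \<open>y \<in> Y\<close> unfolding Y_def by (rule imageE)
    then show ?thesis
      by (intro exI[of _ "fst p"] exI[of _ "snd p"]) (simp add: U_def pt_def case_prod_beta' mem_Times_iff)
  qed
  have cardW: "card W = n"
    using l by (simp add: W_def card_image inj_on_def)
  have NW: "n ^ 3 * card W = n ^ 4" by (simp add: cardW eval_nat_numeral)
  define r where "r = real (n\<^sup>2) * C"
  have n2: "1 \<le> real (n\<^sup>2)" using n0 by (simp add: Suc_leI)
  have r: "1 \<le> r" unfolding r_def using mult_mono[OF n2 C] C by simp
  have size_s: "acts_on_span V (real c * s) (int H)" and size_e: "has_size V c H 1 (exp l)"
    and size_es: "has_size V c H 1 (exp (l * s))"
    using size[of s] size[of "exp l"] size[of "exp (l * s)"] by (simp_all add: has_size_def)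
  show False
  proof (rule exponential_values_contradiction[OF V, where W = W and Y = Y and N = "n ^ 3" and r = r
        and Q = "Q n" and D = "c ^ (3 * n ^ 3)" and T = T])
    show "finite W" "finite Y" by (simp_all add: W_def Y_def U_def)
    show "n ^ 3 * card W \<le> card Y" unfolding NW cardY ..
    show "0 < r" using r by simp
    show "\<bar>y\<bar> \<le> r" if y: "y \<in> Y" for y
    proof -
      obtain u v where uv: "u < n\<^sup>2" "v < n\<^sup>2" "y = real u + real v * s"
        using Y_elem[OF y] by blast
      have "\<bar>y\<bar> \<le> real u + real v * \<bar>s\<bar>"
        unfolding uv(3) by (rule order_trans[OF abs_triangle_ineq]) (simp add: abs_mult)
      also have "\<dots> \<le> real (n\<^sup>2) + real (n\<^sup>2) * \<bar>s\<bar>"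
        using uv by (intro add_mono mult_right_mono) auto
      finally show ?thesis by (simp add: r_def C_def algebra_simps)
    qed
    show "(2 * r) ^ a * exp (\<bar>\<omega>\<bar> * (2 * r)) \<le> real (Q n)"
      if a\<omega>: "a < n ^ 3" "\<omega> \<in> W" for a \<omega>
    proof -
      obtain b where b: "b < n" "\<omega> = real b * l" using a\<omega> unfolding W_def by blast
      have "\<bar>\<omega>\<bar> * (2 * r) \<le> (real n * \<bar>l\<bar>) * (2 * r)"
        unfolding b(2) abs_mult using b(1) r by (intro mult_right_mono) auto
      also have "\<dots> = real (n ^ 3) * (2 * \<bar>l\<bar> * C)"
        by (simp add: r_def power2_eq_square power3_eq_cube)
      finally have "exp (\<bar>\<omega>\<bar> * (2 * r)) \<le> exp (2 * \<bar>l\<bar> * C) ^ (n ^ 3)"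
        by (subst exp_of_nat_mult[symmetric]) simp
      moreover have "(2 * r) ^ a \<le> (2 * r) ^ (n ^ 3)"
        using a\<omega> r by (intro power_increasing) auto
      ultimately have "(2 * r) ^ a * exp (\<bar>\<omega>\<bar> * (2 * r)) \<le> (2 * r) ^ (n ^ 3) * exp (2 * \<bar>l\<bar> * C) ^ (n ^ 3)"
        using r by (intro mult_mono) auto
      also have "\<dots> = (2 * C * exp (2 * \<bar>l\<bar> * C) * real (n\<^sup>2)) ^ (n ^ 3)"
        unfolding power_mult_distrib[symmetric] r_def by (simp only: mult_ac)
      also have "\<dots> \<le> (real M * real (n\<^sup>2)) ^ (n ^ 3)"
        using C by (intro power_mono mult_right_mono CM) auto
      finally show ?thesis by (simp add: Q_def)
    qed
    have DQ: "(2 * H * n\<^sup>2) ^ (n ^ 3) * H ^ (2 * n ^ 3) \<le> Q n"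
    proof -
      have "(2 * H * n\<^sup>2) ^ (n ^ 3) * H ^ (2 * n ^ 3) = (2 * H ^ 3 * n\<^sup>2) ^ (n ^ 3)"
        unfolding power_mult power_mult_distrib[symmetric]
        by (simp only: power2_eq_square power3_eq_cube mult_ac)
      also have "\<dots> \<le> Q n" unfolding Q_def by (intro power_mono mult_le_mono1 M) simp
      finally show ?thesis .
    qed
    show "1 \<le> c ^ (3 * n ^ 3)" using c by simp
    have "c ^ (3 * n ^ 3) = c ^ (n ^ 3) * c ^ (2 * n ^ 3)"
      by (simp only: power_add[symmetric]) simp
    also have "\<dots> \<le> (2 * H * n\<^sup>2) ^ (n ^ 3) * H ^ (2 * n ^ 3)"
    proof (intro mult_le_mono power_mono c(2))
      have "c * 1 \<le> (2 * H) * n\<^sup>2" using c n0 by (intro mult_le_mono) auto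
      then show "c \<le> 2 * H * n\<^sup>2" by simp
    qed auto
    finally show "c ^ (3 * n ^ 3) \<le> Q n" using DQ by (rule order_trans)
    show "acts_on_span V (real (c ^ (3 * n ^ 3)) * (y ^ a * exp (\<omega> * y))) (int (Q n))"
      if awy: "a < n ^ 3" "\<omega> \<in> W" "y \<in> Y" for a \<omega> y
    proof -
      obtain b where b: "b < n" "\<omega> = real b * l" using awy unfolding W_def by blast
      obtain u v where uv: "u < n\<^sup>2" "v < n\<^sup>2" "y = real u + real v * s"
        using Y_elem[OF awy(3)] by blast
      have act: "acts_on_span V (of_int (int (c * u)) + of_int (int v) * (real c * s)) (\<bar>int (c * u)\<bar> + \<bar>int v\<bar> * int H)"
        by (intro acts_on_span_add acts_on_span_mult acts_on_span_of_int V size_s) simp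
      have y: "of_int (int (c * u)) + of_int (int v) * (real c * s) = real c * y"
        by (simp add: uv(3) algebra_simps)
      have yH: "\<bar>int (c * u)\<bar> + \<bar>int v\<bar> * int H \<le> int (2 * H * n\<^sup>2)"
      proof -
        have "c * u \<le> H * n\<^sup>2" "v * H \<le> n\<^sup>2 * H" using c uv by (auto intro!: mult_le_mono)
        moreover have "2 * H * n\<^sup>2 = H * n\<^sup>2 + n\<^sup>2 * H" by simp
        ultimately have "c * u + v * H \<le> 2 * H * n\<^sup>2" by linarith
        then have "int (c * u + v * H) \<le> int (2 * H * n\<^sup>2)" by (simp only: of_nat_le_iff)
        then show ?thesis by simp
      qed
      have cy: "has_size V c (2 * H * n\<^sup>2) 1 y"
        using acts_on_span_mono[OF act[unfolded y] yH] unfolding has_size_def power_one_right .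
      have cH: "c \<le> 2 * H * n\<^sup>2"
      proof -
        have "c * 1 \<le> (2 * H) * n\<^sup>2" using c n0 by (intro mult_le_mono) auto
        then show ?thesis by simp
      qed
      have "has_size V c (2 * H * n\<^sup>2) a (y ^ a)"
        using has_size_power[OF V(1) cy, of a] by simp
      then have ya: "has_size V c (2 * H * n\<^sup>2) (n ^ 3) (y ^ a)"
        using has_size_mono[OF V(1) cH] awy(1) by simp
      have "exp (\<omega> * y) = exp (real (b * u) * l + real (b * v) * (l * s))"
        by (simp add: b(2) uv(3) algebra_simps)
      also have "\<dots> = exp l ^ (b * u) * exp (l * s) ^ (b * v)"
        by (simp only: exp_add exp_of_nat_mult)
      finally have eq: "exp (\<omega> * y) = exp l ^ (b * u) * exp (l * s) ^ (b * v)" .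
      have "has_size V c H (b * u + b * v) (exp (\<omega> * y))"
        unfolding eq using has_size_mult[OF has_size_power[OF V(1) size_e, of "b * u"] has_size_power[OF V(1) size_es, of "b * v"]]
        by (simp only: mult_1_right)
      moreover have "b * u + b * v \<le> 2 * n ^ 3"
      proof -
        have "b * u \<le> n * n\<^sup>2" "b * v \<le> n * n\<^sup>2" using b uv by (auto intro!: mult_le_mono)
        then show ?thesis by (simp add: power2_eq_square power3_eq_cube)
      qed
      ultimately have e: "has_size V c H (2 * n ^ 3) (exp (\<omega> * y))"
        by (rule has_size_mono[OF V(1) c(2)])
      have act: "acts_on_span V ((real c ^ (n ^ 3) * y ^ a) * (real c ^ (2 * n ^ 3) * exp (\<omega> * y)))
          (int ((2 * H * n\<^sup>2) ^ (n ^ 3)) * int (H ^ (2 * n ^ 3)))"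
        using ya e unfolding has_size_def by (intro acts_on_span_mult) auto
      have prod: "(real c ^ (n ^ 3) * y ^ a) * (real c ^ (2 * n ^ 3) * exp (\<omega> * y)) =
          real (c ^ (3 * n ^ 3)) * (y ^ a * exp (\<omega> * y))"
      proof -
        have "3 * n ^ 3 = n ^ 3 + 2 * n ^ 3" by simp
        then have "real (c ^ (3 * n ^ 3)) = real c ^ (n ^ 3) * real c ^ (2 * n ^ 3)"
          by (simp only: of_nat_power of_nat_mult power_add)
        then show ?thesis by (simp only: mult_ac)
      qed
      have le: "int ((2 * H * n\<^sup>2) ^ (n ^ 3)) * int (H ^ (2 * n ^ 3)) \<le> int (Q n)"
        using DQ by (simp only: of_nat_mult[symmetric] of_nat_le_iff)
      show ?thesis using acts_on_span_mono[OF act le] unfolding prod .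
    qed
    show "0 < T" by (rule T)
    show "(2 * card V + 4) * T \<le> n ^ 3 * card W" using T(2) by (simp only: NW)
    show "2 * (4 * (n ^ 3 * card W)\<^sup>2 * (Q n)\<^sup>2) ^ (2 * card V + 2) < 2 ^ T"
      using large by (simp only: NW)
  qed
qed

section \<open>Units of groups of logarithms\<close>

lemma gp_pos:
  assumes "\<And>p. p \<in> P \<Longrightarrow> 0 < p" "x \<in> gp P"
  shows "0 < x"
  using subgroup.subset[OF subgroup_gp[OF assms(1)]] assms(2)
  by (auto simp: pos_real_mult_group_def)

lemma gp_lattice_algebraic:
  assumes P: "\<And>p. p \<in> P \<Longrightarrow> 0 < p \<and> algebraic p" and "x \<in> gp P"
  shows "lattice_algebraic {x}"
  using assms(2) unfolding gp_def
proof (induction rule: generate.induct)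
  case one
  then show ?case by (intro lattice_algebraic_of_algebraic) (simp add: pos_real_mult_group_def rat_imp_algebraic)
next
  case (incl h)
  then show ?case using P by (intro lattice_algebraic_of_algebraic) auto
next
  case (inv h)
  then show ?case
    using P[OF inv] by (intro lattice_algebraic_of_algebraic) (auto simp: inv_pos_real_mult_group)
next
  case (eng h1 h2)
  then show ?case by (simp add: pos_real_mult_group_def lattice_algebraic_mult)
qed

text \<open>
  A basis element is not a proper multiple of any element, because its coordinate at itself is 1.
\<close>

lemma free_abelian_not_divisible:
  assumes free: "free_abelian_positive_rank (real_add_group\<lparr>carrier := B\<rparr>)"
    and d: "\<And>b. b \<in> B \<Longrightarrow> \<exists>b'\<in>B. b = real d * b'"
  shows "d = 1"
proof -
  let ?G = "real_add_group\<lparr>carrier := B\<rparr>"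
  obtain S :: "real set" and h where S: "S \<noteq> {}" and h: "h \<in> iso (free_Abelian_group S) ?G"
    using free unfolding free_abelian_positive_rank_def is_iso_def by blast
  obtain x where x: "x \<in> S" using S by blast
  have hom: "h \<in> hom (free_Abelian_group S) ?G" and bij: "bij_betw h (carrier (free_Abelian_group S)) B"
    using h by (auto simp: iso_def)
  have add: "h (a + b) = h a + h b" if "a \<in> carrier (free_Abelian_group S)" "b \<in> carrier (free_Abelian_group S)" for a b
    using hom that by (auto simp: hom_def real_add_group_def)
  have fx: "frag_of x \<in> carrier (free_Abelian_group S)" using x by simp
  then have "h (frag_of x) \<in> B" using bij by (auto simp: bij_betw_def)
  then obtain b where b: "b \<in> B" "h (frag_of x) = real d * b" using d by blast
  obtain c where c: "c \<in> carrier (free_Abelian_group S)" "h c = b"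
    using bij b(1) by (auto simp: bij_betw_def)
  have keys: "frag_cmul k c \<in> carrier (free_Abelian_group S)" for k
    using c(1) keys_cmul[of k c] by auto
  have mult: "h (frag_cmul (int k) c) = real k * b" for k
  proof (induction k)
    case 0
    have "h (0 + 0) = h 0 + h 0" using keys[of 0] by (intro add) auto
    then show ?case by simp
  next
    case (Suc k)
    have "frag_cmul (int (Suc k)) c = frag_cmul (int k) c + c"
      by (simp add: frag_cmul_distrib)
    then have "h (frag_cmul (int (Suc k)) c) = h (frag_cmul (int k) c) + h c"
      using add[OF keys c(1)] by simp
    then show ?case using Suc c(2) by (simp add: algebra_simps)
  qed
  have "frag_of x = frag_cmul (int d) c"
    using bij fx keys[of "int d"] mult[of d] b(2) by (auto simp: bij_betw_def inj_on_def)
  then have "poly_mapping.lookup (frag_of x) x = poly_mapping.lookup (frag_cmul (int d) c) x" by simp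
  then have "1 = int d * poly_mapping.lookup c x" by simp
  then show ?thesis using zmult_eq_1_iff by auto
qed

lemma free_abelian_nonzero:
  assumes free: "free_abelian_positive_rank (real_add_group\<lparr>carrier := B\<rparr>)"
  obtains b where "b \<in> B" "b \<noteq> 0"
proof -
  let ?G = "real_add_group\<lparr>carrier := B\<rparr>"
  obtain S :: "real set" and h where S: "S \<noteq> {}" and h: "h \<in> iso (free_Abelian_group S) ?G"
    using free unfolding free_abelian_positive_rank_def is_iso_def by blast
  obtain x where x: "x \<in> S" using S by blast
  have bij: "bij_betw h (carrier (free_Abelian_group S)) B"
    using h by (auto simp: iso_def)
  have "frag_of x \<in> carrier (free_Abelian_group S)" "0 \<in> carrier (free_Abelian_group S)" using x by simp_all
  moreover have "frag_of x \<noteq> 0" by simp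
  ultimately have "h (frag_of x) \<in> B" "h 0 \<in> B" "h (frag_of x) \<noteq> h 0"
    using bij_betwE[OF bij] inj_on_eq_iff[OF bij_betw_imp_inj_on[OF bij]] by blast+
  then show thesis using that by metis
qed

text \<open>
  Write \<open>s = p / q\<close> in lowest terms. With \<open>i p + j q = 1\<close> every \<open>b\<close> in \<open>B\<close> equals
  \<open>q (i s b + j b)\<close>, so \<open>B\<close> is divisible by \<open>q\<close>; hence \<open>q = 1\<close>, and then \<open>B = p B\<close> is divisible by \<open>p\<close>.
\<close>

lemma rational_unit_eq_one:
  assumes B: "subgroup B real_add_group" and free: "free_abelian_positive_rank (real_add_group\<lparr>carrier := B\<rparr>)"
    and s: "s \<in> unit_group B" "s \<in> \<rat>"
  shows "s = 1 \<or> s = -1"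
proof -
  have add: "a + b \<in> B" if "a \<in> B" "b \<in> B" for a b
    using subgroup.m_closed[OF B that] by (simp add: real_add_group_def)
  have neg: "- a \<in> B" if "a \<in> B" for a
    using subgroup.m_inv_closed[OF B that] by (simp add: inv_real_add_group)
  have zero: "0 \<in> B" using subgroup.one_closed[OF B] by (simp add: real_add_group_def)
  have nat: "real k * b \<in> B" if "b \<in> B" for k b
    by (induction k) (use that zero add in \<open>auto simp: algebra_simps\<close>)
  have int: "of_int k * b \<in> B" if "b \<in> B" for k b
  proof (cases "0 \<le> k")
    case True
    then show ?thesis using nat[OF that, of "nat k"] by simp
  next
    case False
    then show ?thesis using neg[OF nat[OF that, of "nat (- k)"]] by simp
  qed
  have img: "(\<lambda>b. s * b) ` B = B" using s(1) by (simp add: unit_group_def)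
  obtain p q where pq: "0 < q" "coprime p q" "s = of_int p / of_int q"
    using s(2) by (auto elim: Rats_cases')
  obtain i j where ij: "i * p + j * q = 1"
    using pq(2) bezout_int[of p q] by (metis coprime_iff_gcd_eq_1)
  have q: "nat q = 1"
  proof (rule free_abelian_not_divisible[OF free])
    fix b assume b: "b \<in> B"
    then have "s * b \<in> B" using img by blast
    then have "of_int i * (s * b) + of_int j * b \<in> B" using b int add by blast
    moreover have "b = real (nat q) * (of_int i * (s * b) + of_int j * b)"
    proof -
      have "real (nat q) * (of_int i * (s * b) + of_int j * b) = (of_int i * of_int p + of_int j * of_int q) * b"
        using pq(1) by (simp add: pq(3) field_simps)
      also have "(of_int i * of_int p + of_int j * of_int q :: real) = of_int (i * p + j * q)" by simp
      finally show ?thesis by (simp add: ij)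
    qed
    ultimately show "\<exists>b'\<in>B. b = real (nat q) * b'" by blast
  qed
  then have "q = 1" using pq(1) by (simp add: nat_eq_iff)
  then have sp: "s = of_int p" using pq(3) by simp
  have "nat \<bar>p\<bar> = 1"
  proof (rule free_abelian_not_divisible[OF free])
    fix b assume "b \<in> B"
    then obtain b' where b': "b' \<in> B" "b = of_int p * b'" using img sp by blast
    show "\<exists>b'\<in>B. b = real (nat \<bar>p\<bar>) * b'"
    proof (cases "0 \<le> p")
      case True
      then show ?thesis using b' by (intro bexI[of _ b']) auto
    next
      case False
      then show ?thesis using b' neg by (intro bexI[of _ "- b'"]) auto
    qed
  qed
  then show ?thesis using sp by (auto simp: abs_if split: if_splits)
qed

theorem proposition6p13:
  fixes P B :: "real set"
  assumes "\<And>p. p \<in> P \<Longrightarrow> 0 < p \<and> algebraic p"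
    and "B = ln ` gp P"
    and "free_abelian_positive_rank (real_add_group\<lparr>carrier := B\<rparr>)"
  shows "unit_group B = {1, -1}"
proof -
  have pos: "\<And>p. p \<in> P \<Longrightarrow> 0 < p" using assms(1) by blast
  have B: "subgroup B real_add_group" unfolding assms(2) using pos by (rule subgroup_ln_gp)
  have neg: "- a \<in> B" if "a \<in> B" for a
    using subgroup.m_inv_closed[OF B that] by (simp add: inv_real_add_group)
  have "(\<lambda>b. - b) ` B = B"
  proof
    show "(\<lambda>b. - b) ` B \<subseteq> B" using neg by blast
    show "B \<subseteq> (\<lambda>b. - b) ` B"
    proof
      fix b assume "b \<in> B"
      then have "b = - (- b)" "- b \<in> B" using neg by simp_all
      then show "b \<in> (\<lambda>b. - b) ` B" by (rule image_eqI)
    qed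
  qed
  then have "{1, -1} \<subseteq> unit_group B" by (simp add: unit_group_def)
  moreover have "s = 1 \<or> s = -1" if s: "s \<in> unit_group B" for s
  proof (rule ccontr)
    assume "\<not> (s = 1 \<or> s = -1)"
    then have irr: "s \<notin> \<rat>" using rational_unit_eq_one[OF B assms(3) s] by blast
    obtain l where l: "l \<in> B" "l \<noteq> 0" using free_abelian_nonzero[OF assms(3)] by blast
    have "l * s ^ k \<in> B" for k
    proof (induction k)
      case (Suc k)
      then have "s * (l * s ^ k) \<in> (\<lambda>b. s * b) ` B" by blast
      then show ?case using s by (simp add: unit_group_def mult_ac)
    qed (use l in simp)
    then have alg: "lattice_algebraic {exp (l * s ^ k)}" for k
    proof -
      obtain x where "x \<in> gp P" "l * s ^ k = ln x" using \<open>\<And>k. l * s ^ k \<in> B\<close> assms(2) by blast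
      then show ?thesis using gp_lattice_algebraic[OF assms(1)] gp_pos[OF pos] by auto
    qed
    show False
    proof (cases "algebraic s")
      case True
      then show False
        using irrational_algebraic_multiplier_contradiction[OF l(2) irr lattice_algebraic_of_algebraic[OF True]]
          alg[of 0] alg[of 1] by simp
    next
      case False
      then show False using transcendental_multiplier_contradiction[OF l(2) False] alg by blast
    qed
  qed
  ultimately show ?thesis by blast
qed

end
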